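(* Let $A$ be a unital C*-algebra and $\mathcal H$ be a finitely or countably generated Hilbert $A$-module. Every standard frame of $\mathcal H$ is a multiple of the sum of two standard normalized tight frames of $\mathcal H$; that is, for every standard frame $\{f_j\}_{j\in\mathbb J}$ of $\mathcal H$ there are a scalar $\lambda$ and two standard normalized tight frames $\{g_j\}_{j\in\mathbb J}$, $\{h_j\}_{j\in\mathbb J}$ of $\mathcal H$ such that $f_j=\lambda(g_j+h_j)$ for every $j\in\mathbb J$.
   Context: Hilbert $A$-modules are left modules whose $A$-valued inner product is $A$-linear in the first argument. A Hilbert $A$-module is finitely generated if it is the $A$-linear span of a finite subset; it is countably generated if the finite $A$-linear combinations of some countable subset are norm-dense. Let $\mathbb J$ be a finite or countable index set. A sequence $\{x_j\}_{j\in\mathbb J}$ in a Hilbert $A$-module $\mathcal H$ is a frame if there are real constants $C,D>0$ with $C\langle x,x\rangle\le\sum_j\langle x,x_j\rangle\langle x_j,x\rangle\le D\langle x,x\rangle$ for every $x\in\mathcal H$. It is standard if the middle sum converges in norm for every $x$, and normalized tight if one can take $C=D=1$. *)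

theory Defs
  imports "HOL-Analysis.Analysis"
begin

class complex_vector = real_vector +
  fixes scaleC :: "complex \<Rightarrow> 'a \<Rightarrow> 'a"  (infixr "*\<^sub>C" 75)
  assumes scaleC_add_right: "c *\<^sub>C (x + y) = c *\<^sub>C x + c *\<^sub>C y"
    and scaleC_add_left: "(c + d) *\<^sub>C x = c *\<^sub>C x + d *\<^sub>C x"
    and scaleC_scaleC: "c *\<^sub>C d *\<^sub>C x = (c * d) *\<^sub>C x"
    and scaleC_one: "1 *\<^sub>C x = x"
    and scaleR_scaleC: "r *\<^sub>R x = complex_of_real r *\<^sub>C x"

class complex_banach = complex_vector + banach +
  assumes norm_scaleC: "norm (c *\<^sub>C x) = cmod c * norm x"

(* Class monoid_mult rather than ring_1 supplies the unit, so that the zero algebra is not excluded. *)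
class unital_cstar_algebra = complex_banach + real_normed_algebra + monoid_mult +
  fixes star :: "'a \<Rightarrow> 'a"
  assumes mult_scaleC_left: "(c *\<^sub>C a) * b = c *\<^sub>C (a * b)"
    and mult_scaleC_right: "a * (c *\<^sub>C b) = c *\<^sub>C (a * b)"
    and star_add: "star (a + b) = star a + star b"
    and star_scaleC: "star (c *\<^sub>C a) = cnj c *\<^sub>C star a"
    and star_mult: "star (a * b) = star b * star a"
    and star_star: "star (star a) = a"
    and cstar_identity: "norm (star a * a) = (norm a)\<^sup>2"

definition cstar_spectrum :: "'a::unital_cstar_algebra \<Rightarrow> complex set" where
  "cstar_spectrum a =
     {z. \<not> (\<exists>b. b * (a - z *\<^sub>C 1) = 1 \<and> (a - z *\<^sub>C 1) * b = 1)}"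

definition cstar_positive :: "'a::unital_cstar_algebra \<Rightarrow> bool" where
  "cstar_positive a \<longleftrightarrow>
     star a = a \<and> cstar_spectrum a \<subseteq> complex_of_real ` {0..}"

definition cstar_le :: "'a::unital_cstar_algebra \<Rightarrow> 'a \<Rightarrow> bool"  (infix "\<preceq>" 50) where
  "a \<preceq> b \<longleftrightarrow> cstar_positive (b - a)"

(* Axiom norm_ip ties the norm of the underlying Banach space to the inner product, so
   class complex_banach expresses completeness for the Hilbert module norm. *)
locale hilbert_module =
  fixes act :: "'a::unital_cstar_algebra \<Rightarrow> 'h::complex_banach \<Rightarrow> 'h"
    and ip :: "'h \<Rightarrow> 'h \<Rightarrow> 'a"
  assumes act_add_left: "act (a + b) x = act a x + act b x"
    and act_add_right: "act a (x + y) = act a x + act a y"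
    and act_mult: "act (a * b) x = act a (act b x)"
    and act_one: "act 1 x = x"
    and act_scaleC_left: "act (c *\<^sub>C a) x = c *\<^sub>C act a x"
    and act_scaleC_right: "act a (c *\<^sub>C x) = c *\<^sub>C act a x"
    and ip_add_left: "ip (x + y) z = ip x z + ip y z"
    and ip_act_left: "ip (act a x) y = a * ip x y"
    and star_ip: "star (ip x y) = ip y x"
    and ip_positive: "cstar_positive (ip x x)"
    and ip_definite: "ip x x = 0 \<Longrightarrow> x = 0"
    and norm_ip: "norm x = sqrt (norm (ip x x))"

definition act_span :: "('a::unital_cstar_algebra \<Rightarrow> 'h::complex_banach \<Rightarrow> 'h) \<Rightarrow> 'h set \<Rightarrow> 'h set" where
  "act_span act S = {\<Sum>s\<in>F. act (c s) s | F c. finite F \<and> F \<subseteq> S}"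

definition finitely_generated :: "('a::unital_cstar_algebra \<Rightarrow> 'h::complex_banach \<Rightarrow> 'h) \<Rightarrow> bool" where
  "finitely_generated act \<longleftrightarrow> (\<exists>S. finite S \<and> act_span act S = UNIV)"

definition countably_generated :: "('a::unital_cstar_algebra \<Rightarrow> 'h::complex_banach \<Rightarrow> 'h) \<Rightarrow> bool" where
  "countably_generated act \<longleftrightarrow> (\<exists>S. countable S \<and> closure (act_span act S) = UNIV)"

(* Norm convergence is unordered summability over J; the terms being positive, this
   agrees with convergence of the partial sums for any one enumeration of J. *)
definition standard_frame_bounds ::
    "real \<Rightarrow> real \<Rightarrow> ('h::complex_banach \<Rightarrow> 'h \<Rightarrow> 'a::unital_cstar_algebra) \<Rightarrow> 'j set \<Rightarrow> ('j \<Rightarrow> 'h) \<Rightarrow> bool" where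
  "standard_frame_bounds C D ip J f \<longleftrightarrow>
     (\<forall>x. (\<lambda>j. ip x (f j) * ip (f j) x) summable_on J \<and>
          C *\<^sub>R ip x x \<preceq> (\<Sum>\<^sub>\<infinity>j\<in>J. ip x (f j) * ip (f j) x) \<and>
          (\<Sum>\<^sub>\<infinity>j\<in>J. ip x (f j) * ip (f j) x) \<preceq> D *\<^sub>R ip x x)"

definition standard_frame ::
    "('h::complex_banach \<Rightarrow> 'h \<Rightarrow> 'a::unital_cstar_algebra) \<Rightarrow> 'j set \<Rightarrow> ('j \<Rightarrow> 'h) \<Rightarrow> bool" where
  "standard_frame ip J f \<longleftrightarrow> (\<exists>C>0. \<exists>D>0. standard_frame_bounds C D ip J f)"

definition standard_normalized_tight_frame ::
    "('h::complex_banach \<Rightarrow> 'h \<Rightarrow> 'a::unital_cstar_algebra) \<Rightarrow> 'j set \<Rightarrow> ('j \<Rightarrow> 'h) \<Rightarrow> bool" where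
  "standard_normalized_tight_frame ip J f \<longleftrightarrow> standard_frame_bounds 1 1 ip J f"

end

(* Let S be the frame operator, S x = sum_j <x, f_j> f_j, which is positive and invertible, and write
   S = d (1 - A) with A selfadjoint of norm less than 1. The operator W = ((1 + A) / (1 - A))^(1/2)
   is selfadjoint, commutes with S and satisfies S (1 + W^2) = 2 d. Hence G = (1 + i W) / sqrt (2 d)
   satisfies G S G* = G* S G = 1, so that (G f_j) and (G* f_j) are normalized tight frames, and
   G f_j + G* f_j = 2 f_j / sqrt (2 d). Up to the factor S^(1/2), the operators G and G* are the two
   unitaries whose average is a multiple of S^(1/2).
   Convergence of the series for S and the bound on A need Cauchy-Schwarz inequalities with values
   in A, which rest on the positivity of a* a. The order theory of a C*-algebra is obtained without
   Gelfand duality or the complex-analytic spectral radius formula. *)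
theory Submission
  imports Defs
begin

subsection \<open>Inverses and power series in Banach algebras\<close>

text \<open>Where \<open>W\<close> comes from: for c = S^(1/2) / sqrt (2 d), the unitaries with
  average c are c +- i sqrt (1 - c^2). Cancelling the factor S^(1/2) leaves a multiple of 1 +- i W,
  so S^(1/2) itself is never formed. The constant 2 d turns W^2 = 2 d / S - 1 into (1 + A) / (1 - A)
  = (1 + A)^2 / (1 - A^2), whence a single binomial series in A^2, of norm less than 1, yields W.
  Operators on the module are handled only as a Banach algebra: selfadjointness is expressed through
  \<open>ip\<close>, and order bounds become norm bounds by Cauchy-Schwarz. In the coefficient
  algebra, positivity is defined by the spectrum, which is hard to follow through sums and limits;
  the criterion norm (t - a) \<le> t takes its place, and it rests on bounding the norm of a
  selfadjoint element by its spectrum.\<close>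

definition inverses :: "'a::monoid_mult \<Rightarrow> 'a \<Rightarrow> bool" where
  "inverses a b \<longleftrightarrow> b * a = 1 \<and> a * b = 1"

lemma inverses_mult:
  assumes "inverses a b" "inverses c d"
  shows "inverses (a * c) (d * b)"
proof -
  have "d * b * (a * c) = d * (b * a) * c" "a * c * (d * b) = a * (c * d) * b"
    by (simp_all only: mult.assoc)
  with assms show ?thesis unfolding inverses_def by simp
qed

text \<open>The product \<open>b * c\<close> is a left inverse of \<open>a\<close> and
  \<open>c * b\<close> a right inverse, so they agree.\<close>

lemma inverses_factor:
  assumes "inverses (a * c) b" "a * c = c * a"
  shows "\<exists>d. inverses a d"
proof -
  have 1: "a * (c * b) = 1" "(b * c) * a = 1"
    using assms unfolding inverses_def by (metis mult.assoc)+
  hence "b * c = b * c * (a * (c * b))" by simp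
  also have "\<dots> = c * b" using 1 by (metis mult.assoc mult_1_left)
  finally show ?thesis using 1 unfolding inverses_def by metis
qed

lemma inverses_commute:
  assumes "inverses a b" "a * c = c * a"
  shows "b * c = c * b"
proof -
  have "b * c = b * (c * a) * b"
    using assms(1) by (simp add: inverses_def mult.assoc)
  also have "\<dots> = c * b"
    using assms by (metis inverses_def mult.assoc mult_1_left)
  finally show ?thesis .
qed

text \<open>Class \<^class>\<open>real_normed_algebra_1\<close> would exclude the zero algebra.\<close>
lemma norm_power_le:
  fixes x :: "'a::{real_normed_algebra,monoid_mult}"
  shows "norm (x ^ n) \<le> norm (1::'a) * norm x ^ n"
proof (induction n)
  case (Suc n)
  have "norm (x ^ Suc n) \<le> norm x * norm (x ^ n)"
    by (simp add: norm_mult_ineq)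
  also have "\<dots> \<le> norm x * (norm (1::'a) * norm x ^ n)"
    by (intro mult_left_mono Suc.IH norm_ge_zero)
  finally show ?case by (simp add: mult_ac)
qed simp

lemma summable_norm_scaled_power:
  fixes x :: "'a::{real_normed_algebra,banach,monoid_mult}"
  assumes "norm x < 1" "\<And>n. \<bar>c n\<bar> \<le> 1"
  shows "summable (\<lambda>n. norm (c n *\<^sub>R x ^ n))"
proof (rule summable_comparison_test')
  show "summable (\<lambda>n. norm (1::'a) * norm x ^ n)"
    using assms(1) by (intro summable_mult summable_geometric) simp
  show "norm (norm (c n *\<^sub>R x ^ n)) \<le> norm (1::'a) * norm x ^ n" if "n \<ge> 0" for n
    using mult_mono[OF assms(2)[of n] norm_power_le[of x n]] by simp
qed

lemma inverses_geometric:
  fixes x :: "'a::{real_normed_algebra,banach,monoid_mult}"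
  assumes "norm x < 1"
  shows "inverses (1 - x) (\<Sum>n. x ^ n)"
proof -
  have s: "summable (\<lambda>n. x ^ n)"
    using summable_norm_scaled_power[OF assms, of "\<lambda>_. 1"]
    by (simp add: summable_norm_cancel)
  have "(\<Sum>n. x ^ Suc n) = (\<Sum>n. x ^ n) - 1"
    using suminf_split_head[OF s] by simp
  moreover have "(\<Sum>n. x ^ Suc n) = x * (\<Sum>n. x ^ n)"
    using suminf_mult[OF s, of x] by simp
  moreover have "(\<Sum>n. x ^ Suc n) = (\<Sum>n. x ^ n) * x"
    using suminf_mult2[OF s, of x] by (simp only: power_Suc2)
  ultimately show ?thesis
    by (simp add: inverses_def algebra_simps)
qed

text \<open>The coefficients of the binomial series of \<open>(1 - x)\<close> to the power \<open>-1/2\<close>.\<close>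
definition isqrt_coeff :: "nat \<Rightarrow> real" where
  "isqrt_coeff n = (-1) ^ n * ((- (1/2)) gchoose n)"

text \<open>The square of the series is the geometric series: Vandermonde with -1/2 + -1/2 = -1, and
  the signs cancel.\<close>

lemma isqrt_coeff_conv: "(\<Sum>i\<le>n. isqrt_coeff i * isqrt_coeff (n - i)) = 1"
proof -
  have "(\<Sum>i\<le>n. isqrt_coeff i * isqrt_coeff (n - i)) =
      (\<Sum>i\<le>n. (-1) ^ n * (((- (1/2)) gchoose i) * ((- (1/2)) gchoose (n - i))))"
  proof (rule sum.cong)
    fix i assume "i \<in> {..n}"
    hence "(-1::real) ^ n = (-1) ^ i * (-1) ^ (n - i)"
      by (simp flip: power_add)
    thus "isqrt_coeff i * isqrt_coeff (n - i) =
      (-1) ^ n * (((- (1/2)) gchoose i) * ((- (1/2)) gchoose (n - i)))"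
      by (simp add: isqrt_coeff_def)
  qed simp
  also have "\<dots> = (-1) ^ n * ((- (1/2) + - (1/2)) gchoose n)"
    by (subst gbinomial_Vandermonde[symmetric]) (simp add: sum_distrib_left atLeast0AtMost)
  also have "\<dots> = (-1) ^ n * ((- 1 :: real) gchoose n)"
    by simp
  also have "\<dots> = ((-1) ^ n * (-1) ^ n) * (real n gchoose n)"
    by (simp add: gbinomial_minus)
  also have "\<dots> = 1"
    by (simp flip: power_mult_distrib binomial_gbinomial)
  finally show ?thesis .
qed

text \<open>Reflecting the upper index turns the coefficient into (n - 1/2 choose n), a product of
  positive factors.\<close>

lemma isqrt_coeff_nonneg: "isqrt_coeff n \<ge> 0"
proof -
  have "isqrt_coeff n = ((-1) ^ n * (-1) ^ n) * ((real n - 1/2) gchoose n)"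
    by (simp add: isqrt_coeff_def gbinomial_minus algebra_simps)
  also have "\<dots> = (real n - 1/2) gchoose n"
    by (simp flip: power_mult_distrib)
  also have "\<dots> \<ge> 0"
    unfolding gbinomial_prod_rev by (intro divide_nonneg_nonneg prod_nonneg) auto
  finally show ?thesis .
qed

text \<open>All terms of the convolution identity are nonnegative, and its term at index 0 is the
  coefficient itself.\<close>

lemma isqrt_coeff_le_1: "\<bar>isqrt_coeff n\<bar> \<le> 1"
proof (cases n)
  case 0
  thus ?thesis by (simp add: isqrt_coeff_def)
next
  case (Suc m)
  have "isqrt_coeff 0 * isqrt_coeff (n - 0) \<le> (\<Sum>i\<le>n. isqrt_coeff i * isqrt_coeff (n - i))"
    by (rule member_le_sum) (auto intro: isqrt_coeff_nonneg mult_nonneg_nonneg)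
  moreover have "isqrt_coeff 0 = 1"
    by (simp add: isqrt_coeff_def)
  ultimately show ?thesis
    using isqrt_coeff_nonneg[of n] by (simp add: isqrt_coeff_conv)
qed

text \<open>Absolute convergence permits the Cauchy product, which is the Neumann series of
  \<open>1 - x\<close>. Commutation passes from the powers of \<open>x\<close> to the limit.\<close>

lemma inverse_sqrt_series:
  fixes x :: "'a::{real_normed_algebra,banach,monoid_mult}"
  assumes "norm x < 1"
  obtains e where "(\<lambda>n. isqrt_coeff n *\<^sub>R x ^ n) sums e" "inverses (1 - x) (e * e)"
    "\<And>y. x * y = y * x \<Longrightarrow> e * y = y * e"
proof -
  let ?f = "\<lambda>n. isqrt_coeff n *\<^sub>R x ^ n"
  have s: "summable (\<lambda>n. norm (?f n))"
    by (rule summable_norm_scaled_power[OF assms isqrt_coeff_le_1])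
  hence sums: "?f sums suminf ?f"
    by (rule summable_sums[OF summable_norm_cancel])
  have "suminf ?f * suminf ?f = (\<Sum>k. \<Sum>i\<le>k. ?f i * ?f (k - i))"
    by (rule Cauchy_product[OF s s])
  also have "(\<lambda>k. \<Sum>i\<le>k. ?f i * ?f (k - i)) = (\<lambda>k. x ^ k)"
  proof
    fix k
    have "(\<Sum>i\<le>k. ?f i * ?f (k - i)) = (\<Sum>i\<le>k. (isqrt_coeff i * isqrt_coeff (k - i)) *\<^sub>R x ^ k)"
      by (intro sum.cong) (auto simp flip: power_add)
    thus "(\<Sum>i\<le>k. ?f i * ?f (k - i)) = x ^ k"
      by (simp flip: scaleR_left.sum add: isqrt_coeff_conv)
  qed
  finally have inv: "inverses (1 - x) (suminf ?f * suminf ?f)"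
    using inverses_geometric[OF assms] by simp
  have "suminf ?f * y = y * suminf ?f" if "x * y = y * x" for y
  proof -
    have "x ^ n * y = y * x ^ n" for n
      by (induction n) (simp_all add: mult.assoc, metis that mult.assoc)
    hence "(\<lambda>n. ?f n * y) = (\<lambda>n. y * ?f n)"
      by simp
    moreover have "(\<lambda>n. ?f n * y) sums (suminf ?f * y)" "(\<lambda>n. y * ?f n) sums (y * suminf ?f)"
      by (rule sums_mult2[OF sums], rule sums_mult[OF sums])
    ultimately show ?thesis
      using sums_unique2 by metis
  qed
  with sums inv show thesis by (rule that)
qed

subsection \<open>Scalars and the involution\<close>

lemma scaleC_zero_left [simp]: "(0::complex) *\<^sub>C (x::'a::complex_vector) = 0"
  using scaleR_scaleC[of 0 x] by simp

lemma scaleC_zero_right [simp]: "c *\<^sub>C (0::'a::complex_vector) = 0"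
  using scaleC_add_right[of c 0 "0::'a"] by simp

lemma scaleC_minus_left: "(- c) *\<^sub>C (x::'a::complex_vector) = - (c *\<^sub>C x)"
  using scaleC_add_left[of c "- c" x] by (simp add: eq_neg_iff_add_eq_0 add.commute)

lemma scaleC_minus_right: "c *\<^sub>C (- x::'a::complex_vector) = - (c *\<^sub>C x)"
  using scaleC_add_right[of c x "- x"] by (simp add: eq_neg_iff_add_eq_0 add.commute)

lemma scaleC_diff_left: "(c - d) *\<^sub>C (x::'a::complex_vector) = c *\<^sub>C x - d *\<^sub>C x"
  using scaleC_add_left[of c "- d" x] by (simp add: scaleC_minus_left)

lemma scaleC_diff_right: "c *\<^sub>C (x - y::'a::complex_vector) = c *\<^sub>C x - c *\<^sub>C y"
  using scaleC_add_right[of c x "- y"] by (simp add: scaleC_minus_right)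

lemmas scaleC_simps = scaleC_add_left scaleC_add_right scaleC_diff_left scaleC_diff_right
  scaleC_minus_left scaleC_minus_right scaleC_scaleC scaleC_one mult_scaleC_left mult_scaleC_right

lemma star_zero [simp]: "star (0::'a::unital_cstar_algebra) = 0"
  using star_add[of 0 "0"] by simp

lemma star_minus: "star (- a::'a::unital_cstar_algebra) = - star a"
  using star_add[of a "- a"] by (simp add: eq_neg_iff_add_eq_0 add.commute)

lemma star_diff: "star (a - b::'a::unital_cstar_algebra) = star a - star b"
  using star_add[of a "- b"] by (simp add: star_minus)

lemma star_one [simp]: "star (1::'a::unital_cstar_algebra) = 1"
  by (metis mult_1_left mult_1_right star_mult star_star)

lemma star_scaleR: "star (r *\<^sub>R a::'a::unital_cstar_algebra) = r *\<^sub>R star a"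
  by (simp add: scaleR_scaleC star_scaleC)

lemma norm_star: "norm (star a) = norm (a::'a::unital_cstar_algebra)"
proof -
  have *: "norm b \<le> norm (star b)" for b :: 'a
  proof (cases "b = 0")
    case False
    have "norm b * norm b \<le> norm (star b) * norm b"
      using norm_mult_ineq[of "star b" b] by (simp add: cstar_identity power2_eq_square)
    thus ?thesis using False by simp
  qed simp
  from *[of a] *[of "star a"] show ?thesis by (simp add: star_star)
qed

lemma bounded_linear_star: "bounded_linear (star :: 'a::unital_cstar_algebra \<Rightarrow> 'a)"
  by (rule bounded_linear_intro[where K = 1]) (simp_all add: star_add star_scaleR norm_star)

lemma norm_one_le: "norm (1::'a::unital_cstar_algebra) \<le> 1"
proof -
  have "norm (1::'a) * norm (1::'a) = norm (1::'a)"
    using cstar_identity[of "1::'a"] by (simp add: power2_eq_square)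
  thus ?thesis by (metis mult_cancel_right1 norm_ge_zero order_refl zero_le_one)
qed

lemma norm_power_selfadjoint:
  fixes a :: "'a::unital_cstar_algebra"
  assumes "star a = a"
  shows "norm (a ^ 2 ^ k) = norm a ^ 2 ^ k"
proof (induction k)
  case (Suc k)
  have "star (a ^ n) = a ^ n" for n
    by (induction n) (simp_all add: star_mult assms power_commutes)
  hence "norm (a ^ 2 ^ k * a ^ 2 ^ k) = (norm (a ^ 2 ^ k))\<^sup>2"
    by (metis cstar_identity)
  thus ?case
    by (simp add: Suc.IH power_mult mult.commute[of 2] flip: power_add mult_2)
qed simp

subsection \<open>The spectrum of a selfadjoint element\<close>

lemma cstar_spectrum_iff: "z \<in> cstar_spectrum a \<longleftrightarrow> \<not> (\<exists>b. inverses (a - z *\<^sub>C 1) b)"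
  by (simp add: cstar_spectrum_def inverses_def)

lemma inverses_scaleC:
  fixes a :: "'a::unital_cstar_algebra"
  assumes "inverses a b" "c \<noteq> 0"
  shows "inverses (c *\<^sub>C a) (inverse c *\<^sub>C b)"
  using assms by (simp add: inverses_def scaleC_simps)

text \<open>Invertibility of a product of commuting factors passes to each factor. This stands in
  for spectral mapping: a scalar \<open>q\<close> covers translation, reflection and
  scaling.\<close>

lemma cstar_spectrum_transfer:
  assumes "z \<in> cstar_spectrum a" "y - w *\<^sub>C 1 = (a - z *\<^sub>C 1) * q" "a * q = q * a"
  shows "w \<in> cstar_spectrum y"
proof -
  have "(a - z *\<^sub>C 1) * q = q * (a - z *\<^sub>C 1)"
    using assms(3) by (simp add: algebra_simps scaleC_simps)
  thus ?thesis
    using assms(1,2) inverses_factor[of "a - z *\<^sub>C 1" q] unfolding cstar_spectrum_iff by metis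
qed

lemma cstar_spectrum_norm_le:
  assumes "z \<in> cstar_spectrum a"
  shows "cmod z \<le> norm a"
proof (rule ccontr)
  assume "\<not> cmod z \<le> norm a"
  hence *: "norm a < cmod z" by simp
  hence "z \<noteq> 0" by force
  have "norm (inverse z *\<^sub>C a) < 1"
    using * \<open>z \<noteq> 0\<close> by (simp add: norm_scaleC norm_inverse norm_divide divide_simps)
  from inverses_scaleC[OF inverses_geometric[OF this], of "- z"] \<open>z \<noteq> 0\<close>
  show False
    using assms by (auto simp: cstar_spectrum_iff scaleC_simps)
qed

text \<open>Translation by \<open>i s\<close> moves the spectral point by \<open>i s\<close>, while
  the C*-identity bounds the squared norm by \<open>(norm a)^2 + s^2\<close>; the term linear in
  \<open>s\<close> then forces the imaginary part to vanish.\<close>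

lemma cstar_spectrum_selfadjoint_real:
  fixes a :: "'a::unital_cstar_algebra"
  assumes "star a = a" "z \<in> cstar_spectrum a"
  shows "Im z = 0"
proof (rule ccontr)
  assume nz: "Im z \<noteq> 0"
  have *: "(Re z)\<^sup>2 + (Im z + s)\<^sup>2 \<le> (norm a)\<^sup>2 + s\<^sup>2" for s :: real
  proof -
    let ?s = "\<i> * complex_of_real s"
    have "z + ?s \<in> cstar_spectrum (a + ?s *\<^sub>C 1)"
      by (rule cstar_spectrum_transfer[OF assms(2), of _ _ 1]) (simp_all add: scaleC_simps)
    hence "(cmod (z + ?s))\<^sup>2 \<le> (norm (a + ?s *\<^sub>C 1))\<^sup>2"
      by (intro power_mono cstar_spectrum_norm_le) auto
    also have "\<dots> = norm (star (a + ?s *\<^sub>C 1) * (a + ?s *\<^sub>C 1))"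
      by (simp add: cstar_identity)
    also have "star (a + ?s *\<^sub>C 1) * (a + ?s *\<^sub>C 1) = a * a + s\<^sup>2 *\<^sub>R 1"
      by (simp add: star_add star_scaleC assms(1) algebra_simps scaleC_simps scaleR_scaleC
          power2_eq_square)
    also have "norm \<dots> \<le> norm a * norm a + s\<^sup>2 * 1"
      by (intro order_trans[OF norm_triangle_ineq] add_mono norm_mult_ineq)
        (simp add: mult_left_le norm_one_le)
    finally show ?thesis
      by (simp add: cmod_power2) (simp add: power2_eq_square)
  qed
  \<comment> \<open>The chosen \<open>s\<close> makes the linear term \<open>2 s Im z\<close> equal
    to the square of \<open>norm a\<close>.\<close>
  have "(Re z)\<^sup>2 + (Im z)\<^sup>2 \<le> 0"
    using *[of "(norm a)\<^sup>2 / (2 * Im z)"] nz by (simp add: power2_sum)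
  thus False
    using nz by (simp add: sum_power2_le_zero_iff)
qed

section \<open>Norm and spectral radius of a selfadjoint element\<close>

lemma inverses_average:
  fixes y :: "'a::{real_normed_algebra,monoid_mult}"
  assumes "inverses (1 - y) b" "inverses (1 + y) c"
  shows "inverses (1 - y * y) ((1/2) *\<^sub>R (b + c))"
proof -
  \<comment> \<open>Partial fractions: 1 / (1 - y^2) is the mean of 1 / (1 - y) and 1 / (1 +
    y).\<close>
  have 1: "1 - y * y = (1 - y) * (1 + y)" "1 - y * y = (1 + y) * (1 - y)"
    by (simp_all add: algebra_simps)
  have "b * (1 - y * y) = 1 + y" "c * (1 - y * y) = 1 - y"
    "(1 - y * y) * b = 1 + y" "(1 - y * y) * c = 1 - y"
    using assms unfolding inverses_def 1(1) by (metis 1 mult.assoc mult_1_left mult_1_right)+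
  thus ?thesis
    by (simp add: inverses_def distrib_left distrib_right flip: scaleR_add_left)
qed

lemma resolvent_continuous_on:
  fixes a :: "'a::unital_cstar_algebra"
  assumes inv: "\<And>w. w \<in> K \<Longrightarrow> inverses (1 - w *\<^sub>C a) (R w)"
  shows "continuous_on K R"
  unfolding continuous_on_iff
proof (intro ballI allI impI)
  fix w and e :: real assume w: "w \<in> K" and e: "e > 0"
  define M where "M = (norm a + 1) * (norm (R w) + 1)"
  have M: "M > 0" by (simp add: M_def add_nonneg_pos)
  define N where "N = 2 * M * (norm (R w) + 1)"
  have N: "N > 0" using M by (simp add: N_def add_nonneg_pos)
  \<comment> \<open>The resolvent identity below still contains \<open>R v\<close>. The first bound
    on \<open>v - w\<close> absorbs it, giving \<open>norm (R v) \<le> 2 * (norm (R w) + 1)\<close>;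
    the second then gets below \<open>e\<close>.\<close>
  define d where "d = min (1 / (2 * M)) (e / N)"
  have "d > 0" using M N e by (simp add: d_def)
  moreover have "dist (R v) (R w) < e" if v: "v \<in> K" "dist v w < d" for v
  proof -
    have "R v - R w = R v * ((1 - w *\<^sub>C a) - (1 - v *\<^sub>C a)) * R w"
      using inv[OF w] inv[OF v(1)]
      by (simp only: right_diff_distrib[of "R v" "1 - w *\<^sub>C a"] left_diff_distrib[of _ _ "R w"])
        (simp add: inverses_def mult.assoc)
    also have "\<dots> = (v - w) *\<^sub>C (R v * a * R w)"
      by (simp add: scaleC_simps algebra_simps)
    finally have "norm (R v - R w) = cmod (v - w) * norm (R v * a * R w)"
      by (simp add: norm_scaleC)
    also have "norm (R v * a * R w) \<le> norm (R v) * norm a * norm (R w)"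
      by (intro order_trans[OF norm_mult_ineq] mult_right_mono norm_mult_ineq norm_ge_zero)
    also have "\<dots> \<le> norm (R v) * M"
      unfolding M_def mult.assoc by (intro mult_left_mono mult_mono) auto
    finally have 1: "norm (R v - R w) \<le> cmod (v - w) * (norm (R v) * M)"
      by (simp add: mult_left_mono)
    have 2: "cmod (v - w) * M \<le> 1/2" "cmod (v - w) * N < e"
      using v(2) M N by (auto simp: d_def dist_norm field_simps)
    have "norm (R v) \<le> norm (R w) + norm (R v - R w)"
      by (metis add.commute diff_add_cancel norm_triangle_ineq)
    also have "\<dots> \<le> norm (R w) + (1/2) * norm (R v)"
      using 1 mult_right_mono[OF 2(1), of "norm (R v)"] by (simp add: mult_ac)
    finally have 3: "norm (R v) \<le> 2 * (norm (R w) + 1)" by simp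
    have "norm (R v - R w) \<le> cmod (v - w) * (2 * (norm (R w) + 1) * M)"
      using 1 M 3 by (meson mult_left_mono mult_right_mono norm_ge_zero order_trans less_imp_le)
    with 2(2) show ?thesis by (simp add: dist_norm N_def mult_ac)
  qed
  ultimately show "\<exists>d>0. \<forall>v\<in>K. dist v w < d \<longrightarrow> dist (R v) (R w) < e" by blast
qed

text \<open>Rickart's elementary argument: averaging the resolvents at \<open>w\<close> and \<open>-w\<close> passes from \<open>a\<close> to
  \<open>a\<^sup>2\<close>, so a bound on the difference of resolvents on circles of radius just below and just above 1
  survives repeated squaring.\<close>
lemma selfadjoint_norm_one_spectrum:
  fixes a :: "'a::unital_cstar_algebra"
  assumes sa: "star a = a" and one: "norm a = 1" and r: "0 \<le> r" "r < 1"
  shows "\<exists>z\<in>cstar_spectrum a. r < cmod z"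
proof (rule ccontr)
  assume "\<not> ?thesis"
  hence spec_r: "cmod z \<le> r" if "z \<in> cstar_spectrum a" for z using that by force
  \<comment> \<open>Any \<open>s > 1\<close> with \<open>s * r < 1\<close> serves: a nonzero
    \<open>w\<close> in the disc of radius \<open>s\<close> has its inverse outside the disc of
    radius \<open>r\<close>.\<close>
  define s where "s = 2 / (1 + r)"
  have s: "s > 1" "s * r < 1" using r by (auto simp: s_def field_simps)
  have "\<exists>b. inverses (1 - w *\<^sub>C a) b" if "w \<in> cball 0 s" for w
  proof (cases "w = 0")
    case True thus ?thesis by (auto simp: inverses_def)
  next
    case False
    have "r * cmod w \<le> r * s" using that r by (intro mult_left_mono) auto
    hence "cmod (inverse w) > r" using s(2) False by (simp add: norm_inverse norm_divide field_simps)
    hence "inverse w \<notin> cstar_spectrum a" using spec_r by force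
    then obtain b where "inverses (a - inverse w *\<^sub>C 1) b" by (auto simp: cstar_spectrum_iff)
    from inverses_scaleC[OF this, of "- w"] False show ?thesis
      by (auto simp: scaleC_simps)
  qed
  then obtain R where R: "\<And>w. w \<in> cball 0 s \<Longrightarrow> inverses (1 - w *\<^sub>C a) (R w)" by metis
  have "uniformly_continuous_on (cball 0 s) R"
    by (intro compact_uniformly_continuous resolvent_continuous_on[of _ a] R) auto
  then obtain d where d: "d > 0"
    "\<And>w v. w \<in> cball 0 s \<Longrightarrow> v \<in> cball 0 s \<Longrightarrow> dist v w < d \<Longrightarrow> dist (R v) (R w) < 1/4"
    unfolding uniformly_continuous_on_def by (metis zero_less_divide_1_iff zero_less_numeral)
  \<comment> \<open>Radii on either side of 1 and closer than \<open>d\<close>, so that the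
    resolvents on the two circles differ by at most 1/4; the floor 1/2 keeps \<open>s1\<close>
    positive.\<close>
  define s1 where "s1 = max (1/2) (1 - d/3)"
  define s2 where "s2 = min s (1 + d/3)"
  have s12: "0 < s1" "s1 < 1" "1 < s2" "s2 \<le> s" "s2 - s1 < d"
    using d(1) s by (auto simp: s1_def s2_def max_def min_def)
  define P where "P k \<longleftrightarrow> (\<forall>t. cmod t = 1 \<longrightarrow> (\<exists>b1 b2.
    inverses (1 - (complex_of_real s1 ^ 2 ^ k * t) *\<^sub>C a ^ 2 ^ k) b1 \<and>
    inverses (1 - (complex_of_real s2 ^ 2 ^ k * t) *\<^sub>C a ^ 2 ^ k) b2 \<and> norm (b1 - b2) \<le> 1/4))" for k
  have P: "P k" for k
  proof (induction k)
    case 0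
    show ?case unfolding P_def
    proof (intro allI impI)
      fix t assume t: "cmod t = 1"
      have in_ball: "of_real s1 * t \<in> cball 0 s" "of_real s2 * t \<in> cball 0 s"
        using s12 t by (auto simp: norm_mult)
      have "dist (of_real s1 * t) (of_real s2 * t) = \<bar>s1 - s2\<bar>"
        using t by (simp add: dist_norm norm_mult flip: left_diff_distrib of_real_diff)
      hence "norm (R (of_real s1 * t) - R (of_real s2 * t)) \<le> 1/4"
        using d(2)[OF in_ball(2,1)] s12 by (simp add: dist_norm)
      thus "\<exists>b1 b2. inverses (1 - (complex_of_real s1 ^ 2 ^ 0 * t) *\<^sub>C a ^ 2 ^ 0) b1 \<and>
          inverses (1 - (complex_of_real s2 ^ 2 ^ 0 * t) *\<^sub>C a ^ 2 ^ 0) b2 \<and> norm (b1 - b2) \<le> 1/4"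
        using R in_ball by auto
    qed
  next
    case (Suc k)
    show ?case unfolding P_def
    proof (intro allI impI)
      fix t assume t: "cmod t = 1"
      \<comment> \<open>Both \<open>u\<close> and \<open>- u\<close> have square \<open>t\<close>,
        so averaging their resolvents at level \<open>k\<close> gives the resolvent at
        \<open>t\<close> at the next level.\<close>
      define u where "u = csqrt t"
      have u: "u * u = t" by (simp add: u_def flip: power2_eq_square)
      have "cmod u = 1" using t unfolding u_def by (simp add: norm_csqrt)
      let ?y = "\<lambda>s. (complex_of_real s ^ 2 ^ k * u) *\<^sub>C a ^ 2 ^ k"
      have sq: "(complex_of_real s ^ 2 ^ Suc k * t) *\<^sub>C a ^ 2 ^ Suc k = ?y s * ?y s" for s
      proof -
        have "a ^ 2 ^ Suc k = a ^ 2 ^ k * a ^ 2 ^ k"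
          by (simp add: mult_2 power_add)
        moreover have "complex_of_real s ^ 2 ^ Suc k = of_real s ^ 2 ^ k * of_real s ^ 2 ^ k"
          by (simp add: mult_2 power_add)
        ultimately show ?thesis by (simp add: scaleC_simps mult_ac flip: u)
      qed
      from Suc.IH \<open>cmod u = 1\<close> obtain b1 b2 where b: "inverses (1 - ?y s1) b1"
        "inverses (1 - ?y s2) b2" "norm (b1 - b2) \<le> 1/4" unfolding P_def by meson
      have "cmod (- u) = 1" using \<open>cmod u = 1\<close> by simp
      with Suc.IH obtain c1 c2 where "inverses (1 - (complex_of_real s1 ^ 2 ^ k * - u) *\<^sub>C a ^ 2 ^ k) c1"
        "inverses (1 - (complex_of_real s2 ^ 2 ^ k * - u) *\<^sub>C a ^ 2 ^ k) c2"
        "norm (c1 - c2) \<le> 1/4"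
        unfolding P_def by meson
      hence c: "inverses (1 + ?y s1) c1" "inverses (1 + ?y s2) c2" "norm (c1 - c2) \<le> 1/4"
        by (simp_all add: scaleC_minus_left)
      have "norm ((1/2) *\<^sub>R (b1 + c1) - (1/2) *\<^sub>R (b2 + c2)) =
          norm ((1/2) *\<^sub>R ((b1 - b2) + (c1 - c2)))"
        by (simp add: algebra_simps)
      also have "\<dots> = (1/2) * norm ((b1 - b2) + (c1 - c2))"
        by (simp only: norm_scaleR)
      also have "\<dots> \<le> (1/2) * (1/4 + 1/4)"
        using b(3) c(3) by (intro mult_left_mono order_trans[OF norm_triangle_ineq]) auto
      finally show "\<exists>b1 b2.
          inverses (1 - (complex_of_real s1 ^ 2 ^ Suc k * t) *\<^sub>C a ^ 2 ^ Suc k) b1 \<and>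
          inverses (1 - (complex_of_real s2 ^ 2 ^ Suc k * t) *\<^sub>C a ^ 2 ^ Suc k) b2 \<and>
          norm (b1 - b2) \<le> 1/4"
        unfolding sq using inverses_average[OF b(1) c(1)] inverses_average[OF b(2) c(2)] by auto
    qed
  qed
  have "(\<lambda>n. s1 ^ n) \<longlonglongrightarrow> 0" using s12 by (intro LIMSEQ_power_zero) simp
  then obtain N where N: "\<And>n. n \<ge> N \<Longrightarrow> s1 ^ n \<le> 1/5"
    using s12 by (metis (no_types, lifting) eventually_sequentially less_imp_le order_tendstoD(2)
        zero_less_divide_1_iff zero_less_numeral)
  have "N \<le> 2 ^ N" by (simp add: less_imp_le)
  from P[of N] obtain b1 b2 where b:
    "inverses (1 - (complex_of_real s1 ^ 2 ^ N) *\<^sub>C a ^ 2 ^ N) b1"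
    "inverses (1 - (complex_of_real s2 ^ 2 ^ N) *\<^sub>C a ^ 2 ^ N) b2" "norm (b1 - b2) \<le> 1/4"
    unfolding P_def by (metis mult.right_neutral norm_one)
  let ?y1 = "(complex_of_real s1 ^ 2 ^ N) *\<^sub>C a ^ 2 ^ N"
  let ?y2 = "(complex_of_real s2 ^ 2 ^ N) *\<^sub>C a ^ 2 ^ N"
  have y1: "norm ?y1 \<le> 1/5"
    using N[OF \<open>N \<le> 2 ^ N\<close>] s12 by (simp add: norm_scaleC norm_power norm_power_selfadjoint sa one)
  have y2: "norm ?y2 > 1"
    using s12 by (simp add: norm_scaleC norm_power norm_power_selfadjoint sa one)
  \<comment> \<open>The constants fit together: the bound 1/5 on \<open>?y1\<close> puts
    \<open>b1\<close> within (1/5) / (1 - 1/5) = 1/4 of 1, hence \<open>b2\<close> within 1/2 of 1,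
    and then \<open>norm ?y2\<close> is at most (1/2) / (1 - 1/2) = 1.\<close>
  have e1: "b1 - 1 = ?y1 + (b1 - 1) * ?y1" and e2: "?y2 = (b2 - 1) - (b2 - 1) * ?y2"
    using b(1,2) by (simp_all add: inverses_def algebra_simps)
  have "norm (b1 - 1) \<le> norm ?y1 + norm (b1 - 1) * norm ?y1"
    by (subst e1) (intro order_trans[OF norm_triangle_ineq] add_left_mono norm_mult_ineq)
  also have "\<dots> \<le> 1/5 + norm (b1 - 1) * (1/5)"
    using y1 by (intro add_mono mult_left_mono) auto
  finally have "norm (b1 - 1) \<le> 1/4" by simp
  hence b2: "norm (b2 - 1) \<le> 1/2"
    using b(3) norm_triangle_ineq4[of "b1 - 1" "b1 - b2"] by simp
  have "norm ?y2 \<le> norm (b2 - 1) + norm (b2 - 1) * norm ?y2"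
    by (subst e2) (intro order_trans[OF norm_triangle_ineq4] add_left_mono norm_mult_ineq)
  also have "\<dots> \<le> 1/2 + 1/2 * norm ?y2"
    using b2 by (intro add_mono mult_right_mono) auto
  finally show False using y2 by simp
qed

lemma selfadjoint_norm_le_spectrum:
  fixes a :: "'a::unital_cstar_algebra"
  assumes sa: "star a = a" and r: "0 \<le> r" and spec_r: "\<And>z. z \<in> cstar_spectrum a \<Longrightarrow> cmod z \<le> r"
  shows "norm a \<le> r"
proof (rule ccontr)
  assume "\<not> norm a \<le> r"
  hence n: "r < norm a" by simp
  hence pos: "norm a > 0" using r by linarith
  define b where "b = complex_of_real (1 / norm a) *\<^sub>C a"
  have "star b = b" by (simp add: b_def star_scaleC sa)
  moreover have "norm b = 1" using pos unfolding b_def norm_scaleC norm_of_real by simp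
  moreover have "r / norm a < 1" "0 \<le> r / norm a" using n r pos by simp_all
  ultimately obtain z where z: "z \<in> cstar_spectrum b" "r / norm a < cmod z"
    using selfadjoint_norm_one_spectrum by blast
  have "a \<noteq> 0" using pos by simp
  have "of_real (norm a) * z \<in> cstar_spectrum a"
    by (rule cstar_spectrum_transfer[OF z(1), of _ _ "of_real (norm a) *\<^sub>C 1"])
      (use \<open>a \<noteq> 0\<close> in \<open>simp_all add: b_def scaleC_simps algebra_simps\<close>)
  from spec_r[OF this] z(2) pos show False
    by (simp add: norm_mult field_simps)
qed

subsection \<open>Positive elements\<close>

lemma cstar_positive_selfadjoint: "cstar_positive a \<Longrightarrow> star a = a"
  by (simp add: cstar_positive_def)

text \<open>The spectrum is real and lies in the disc of radius \<open>t\<close> about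
  \<open>t\<close>, hence in the nonnegative half-line. Together with the converse below, this
  trades spectra for norms.\<close>

lemma cstar_positive_if_norm:
  assumes "star a = a" "norm (t *\<^sub>R 1 - a) \<le> t"
  shows "cstar_positive a"
  unfolding cstar_positive_def
proof (intro conjI assms(1) subsetI)
  fix z assume z: "z \<in> cstar_spectrum a"
  have im: "Im z = 0" by (rule cstar_spectrum_selfadjoint_real[OF assms(1) z])
  have "of_real t - z \<in> cstar_spectrum (t *\<^sub>R 1 - a)"
    by (rule cstar_spectrum_transfer[OF z, of _ _ "-1"]) (simp_all add: scaleC_simps scaleR_scaleC)
  hence "cmod (of_real t - z) \<le> t"
    using cstar_spectrum_norm_le assms(2) order_trans by blast
  hence "Re (of_real t - z) \<le> t"
    using complex_Re_le_cmod order_trans by blast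
  hence "0 \<le> Re z" by simp
  moreover have "z = complex_of_real (Re z)" using im by (simp add: complex_eq_iff)
  ultimately show "z \<in> complex_of_real ` {0..}" by (metis atLeast_iff image_eqI)
qed

text \<open>The spectrum of \<open>a\<close> lies between 0 and \<open>t\<close>, hence so does that
  of \<open>t - a\<close>, and the spectrum bounds the norm of a selfadjoint element.\<close>

lemma norm_if_cstar_positive:
  assumes "cstar_positive a" "norm a \<le> t"
  shows "norm (t *\<^sub>R 1 - a) \<le> t"
proof (rule selfadjoint_norm_le_spectrum)
  show "star (t *\<^sub>R 1 - a) = t *\<^sub>R 1 - a"
    using assms(1) by (simp add: star_diff star_scaleR cstar_positive_def)
  show "0 \<le> t" using assms(2) norm_ge_zero order_trans by blast
  fix z assume z: "z \<in> cstar_spectrum (t *\<^sub>R 1 - a)"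
  have *: "of_real t - z \<in> cstar_spectrum a"
    by (rule cstar_spectrum_transfer[OF z, of _ _ "-1"]) (simp_all add: scaleC_simps scaleR_scaleC)
  then obtain r where r: "of_real t - z = complex_of_real r" "r \<ge> 0"
    using assms(1) by (auto simp: cstar_positive_def)
  have "r \<le> t" using cstar_spectrum_norm_le[OF *] r assms(2) by simp
  moreover have "z = of_real (t - r)" using r(1) by (simp add: algebra_simps)
  ultimately show "cmod z \<le> t" using r(2) by (simp only: norm_of_real)
qed

lemma cstar_positive_0 [simp]: "cstar_positive 0"
  by (rule cstar_positive_if_norm[of _ 0]) auto

text \<open>In terms of norms this is the triangle inequality, with \<open>t\<close> the sum of the
  two norms.\<close>

lemma cstar_positive_add:
  assumes "cstar_positive a" "cstar_positive b"
  shows "cstar_positive (a + b)"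
proof (rule cstar_positive_if_norm)
  show "star (a + b) = a + b" using assms by (simp add: star_add cstar_positive_def)
  have "norm ((norm a + norm b) *\<^sub>R 1 - (a + b)) \<le> norm (norm a *\<^sub>R 1 - a) + norm (norm b *\<^sub>R 1 - b)"
    by (rule order_trans[OF _ norm_triangle_ineq]) (simp add: algebra_simps)
  also have "\<dots> \<le> norm a + norm b"
    using assms by (intro add_mono norm_if_cstar_positive) auto
  finally show "norm ((norm a + norm b) *\<^sub>R 1 - (a + b)) \<le> norm a + norm b" .
qed

lemma cstar_positive_sum:
  "(\<And>i. i \<in> I \<Longrightarrow> cstar_positive (f i)) \<Longrightarrow> cstar_positive (\<Sum>i\<in>I. f i)"
  by (induction I rule: infinite_finite_induct) (auto intro: cstar_positive_add)

lemma cstar_positive_scaleR: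
  assumes "cstar_positive a" "0 \<le> r"
  shows "cstar_positive (r *\<^sub>R a)"
proof (rule cstar_positive_if_norm)
  show "star (r *\<^sub>R a) = r *\<^sub>R a" using assms by (simp add: star_scaleR cstar_positive_def)
  have "norm ((r * norm a) *\<^sub>R 1 - r *\<^sub>R a) = r * norm (norm a *\<^sub>R 1 - a)"
    using assms(2) by (simp flip: scaleR_scaleR scaleR_diff_right)
  also have "\<dots> \<le> r * norm a"
    using assms by (intro mult_left_mono norm_if_cstar_positive) auto
  finally show "norm ((r * norm a) *\<^sub>R 1 - r *\<^sub>R a) \<le> r * norm a" .
qed

lemma closed_cstar_positive: "closed {a::'a::unital_cstar_algebra. cstar_positive a}"
proof -
  \<comment> \<open>Taking \<open>t = norm a\<close> makes the criterion a closed condition on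
    \<open>a\<close> alone.\<close>
  have "{a::'a. cstar_positive a} = {a. star a = a} \<inter> {a. norm (norm a *\<^sub>R 1 - a) \<le> norm a}"
    using norm_if_cstar_positive cstar_positive_if_norm cstar_positive_selfadjoint by blast
  moreover have "closed {a::'a. star a = a}"
    by (intro closed_Collect_eq linear_continuous_on bounded_linear_star continuous_on_id)
  moreover have "closed {a::'a. norm (norm a *\<^sub>R 1 - a) \<le> norm a}"
    by (intro closed_Collect_le continuous_intros)
  ultimately show ?thesis by (simp add: closed_Int)
qed

lemma cstar_positive_tendsto:
  assumes "(f \<longlongrightarrow> a) F" "F \<noteq> bot" "\<And>x. cstar_positive (f x)"
  shows "cstar_positive a"
  using Lim_in_closed_set[OF closed_cstar_positive _ assms(2,1)] assms(3) by simp

text \<open>Closedness of the cone handles convergent sums; a divergent \<open>infsum\<close> has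
  the default value 0, which is positive too.\<close>

lemma cstar_positive_infsum:
  assumes "\<And>i. i \<in> I \<Longrightarrow> cstar_positive (f i)"
  shows "cstar_positive (\<Sum>\<^sub>\<infinity>i\<in>I. f i)"
proof (cases "f summable_on I")
  case True
  have "(sum f \<longlongrightarrow> infsum f I) (finite_subsets_at_top I)"
    by (rule infsum_tendsto[OF True])
  thus ?thesis
    by (rule Lim_in_closed_set[OF closed_cstar_positive, simplified, rotated 2])
      (auto intro!: eventually_finite_subsets_at_top_weakI cstar_positive_sum assms)
qed (simp add: infsum_not_exists)

lemma cstar_positive_norm_diff:
  assumes "star a = a" "norm a \<le> t"
  shows "cstar_positive (t *\<^sub>R 1 - a)"
  by (rule cstar_positive_if_norm[of _ t]) (use assms in \<open>auto simp: star_diff star_scaleR\<close>)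

lemma norm_le_if_cstar_le_scaleR_one:
  assumes "cstar_positive a" "cstar_positive (r *\<^sub>R 1 - a)" "0 \<le> r"
  shows "norm a \<le> r"
proof (rule selfadjoint_norm_le_spectrum[OF cstar_positive_selfadjoint[OF assms(1)] assms(3)])
  fix z assume z: "z \<in> cstar_spectrum a"
  have "of_real r - z \<in> cstar_spectrum (r *\<^sub>R 1 - a)"
    by (rule cstar_spectrum_transfer[OF z, of _ _ "-1"]) (simp_all add: scaleC_simps scaleR_scaleC)
  then obtain s t where "of_real r - z = complex_of_real s" "s \<ge> 0" "z = complex_of_real t" "t \<ge> 0"
    using assms(1,2) z unfolding cstar_positive_def by blast
  moreover from this have "complex_of_real (r - t) = complex_of_real s" by simp
  hence "r - t = s" by (simp only: of_real_eq_iff)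
  ultimately show "cmod z \<le> r" by simp
qed

lemma norm_mono_cstar_positive:
  assumes "cstar_positive a" "cstar_positive (b - a)"
  shows "norm a \<le> norm b"
proof (rule norm_le_if_cstar_le_scaleR_one[OF assms(1)])
  have "star b = b"
    using assms cstar_positive_add cstar_positive_selfadjoint by fastforce
  hence "cstar_positive (norm b *\<^sub>R 1 - b)"
    by (rule cstar_positive_norm_diff) simp
  from cstar_positive_add[OF this assms(2)] show "cstar_positive (norm b *\<^sub>R 1 - a)" by simp
qed simp

section \<open>Positivity of squares and of products with the adjoint\<close>

lemma cstar_positive_square:
  assumes "star a = a"
  shows "cstar_positive (a * a)"
  unfolding cstar_positive_def
proof (intro conjI subsetI)
  show "star (a * a) = a * a" using assms by (simp add: star_mult)
  fix z assume z: "z \<in> cstar_spectrum (a * a)"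
  define w where "w = csqrt z"
  have w: "w * w = z" by (simp add: w_def flip: power2_eq_square)
  \<comment> \<open>Factoring with a complex square root \<open>w\<close> of \<open>z\<close> puts
    \<open>w\<close> or \<open>- w\<close> into the real spectrum of \<open>a\<close>, so
    \<open>z\<close> is the square of a real number.\<close>
  have *: "a * a - z *\<^sub>C 1 = (a - w *\<^sub>C 1) * (a - (- w) *\<^sub>C 1)"
    by (simp add: algebra_simps scaleC_simps w)
  have "w \<in> cstar_spectrum a \<or> - w \<in> cstar_spectrum a"
  proof (rule ccontr)
    assume "\<not> ?thesis"
    then obtain b c where "inverses (a - w *\<^sub>C 1) b" "inverses (a - (- w) *\<^sub>C 1) c"
      by (auto simp: cstar_spectrum_iff)
    from inverses_mult[OF this] z show False unfolding cstar_spectrum_iff * by blast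
  qed
  hence "Im w = 0" using cstar_spectrum_selfadjoint_real[OF assms] by force
  hence "z = complex_of_real ((Re w)\<^sup>2)" using w by (auto simp: complex_eq_iff power2_eq_square)
  thus "z \<in> complex_of_real ` {0..}" by (metis atLeast_iff image_eqI zero_le_power2)
qed

text \<open>If \<open>c\<close> inverts \<open>b a - z\<close>, then \<open>(a c b - 1) / z\<close>
  inverts \<open>a b - z\<close>, as the formal geometric series of the resolvent suggests.\<close>

lemma cstar_spectrum_mult_commute:
  assumes "z \<in> cstar_spectrum (a * b)" "z \<noteq> 0"
  shows "z \<in> cstar_spectrum (b * a)"
proof (rule ccontr)
  assume "z \<notin> cstar_spectrum (b * a)"
  then obtain c where c: "inverses (b * a - z *\<^sub>C 1) c" by (auto simp: cstar_spectrum_iff)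
  hence *: "b * a * c = 1 + z *\<^sub>C c" "c * (b * a) = 1 + z *\<^sub>C c"
    by (simp_all add: inverses_def algebra_simps scaleC_simps)
  let ?d = "inverse z *\<^sub>C (a * c * b - 1)"
  have "a * c * b * (a * b) = a * (c * (b * a)) * b" "a * b * (a * c * b) = a * (b * a * c) * b"
    by (simp_all only: mult.assoc)
  hence 1: "a * c * b * (a * b) = a * b + z *\<^sub>C (a * c * b)"
    "a * b * (a * c * b) = a * b + z *\<^sub>C (a * c * b)"
    by (simp_all add: * scaleC_simps distrib_left distrib_right)
  have "(a * c * b - 1) * (a * b - z *\<^sub>C 1) = z *\<^sub>C 1" "(a * b - z *\<^sub>C 1) * (a * c * b - 1) = z *\<^sub>C 1"
    by (simp_all add: left_diff_distrib right_diff_distrib 1 scaleC_simps)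
  hence "inverses (a * b - z *\<^sub>C 1) ?d"
    using \<open>z \<noteq> 0\<close> by (simp only: inverses_def mult_scaleC_left mult_scaleC_right)
      (simp add: scaleC_simps)
  thus False using assms(1) by (auto simp: cstar_spectrum_iff)
qed

text \<open>Splitting \<open>a = s + i t\<close> with \<open>s\<close>, \<open>t\<close> selfadjoint.\<close>
lemma cstar_positive_star_mult_add:
  fixes a :: "'a::unital_cstar_algebra"
  shows "cstar_positive (star a * a + a * star a)"
proof -
  let ?s = "a + star a" and ?t = "\<i> *\<^sub>C (a - star a)"
  have "cstar_positive (?s * ?s)" "cstar_positive (?t * ?t)"
    by (intro cstar_positive_square;
        simp add: star_add star_star star_scaleC star_diff scaleC_simps)+
  hence "cstar_positive ((1/2) *\<^sub>R (?s * ?s + ?t * ?t))"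
    by (intro cstar_positive_scaleR cstar_positive_add) auto
  also have "?s * ?s + ?t * ?t = 2 *\<^sub>R (star a * a + a * star a)"
    by (simp add: algebra_simps scaleC_simps scaleR_2)
  finally show ?thesis by simp
qed

text \<open>The heart of the Fukamiya--Kaplansky theorem. If \<open>-1\<close> lay in the spectrum of \<open>h = a* a\<close>,
  put \<open>b = a k\<close> with \<open>k\<close> the inverse of \<open>h + 1 + i\<close>. Then \<open>b* b = h / ((h + 1)\<^sup>2 + 1)\<close> is at most
  \<open>1/4\<close>, hence so is \<open>b b*\<close>, and positivity of \<open>b* b + b b*\<close> gives \<open>b* b \<ge> - 1/4\<close>; but \<open>-1\<close> is
  in the spectrum of \<open>b* b\<close>.\<close>
lemma minus_one_notin_spectrum_star_mult:
  fixes a :: "'a::unital_cstar_algebra"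
  shows "- 1 \<notin> cstar_spectrum (star a * a)"
proof
  define h where "h = star a * a"
  assume "- 1 \<in> cstar_spectrum (star a * a)"
  hence m1: "- 1 \<in> cstar_spectrum h" by (simp add: h_def)
  have sh: "star h = h" by (simp add: h_def star_mult star_star)
  have "(- 1 - \<i>) \<notin> cstar_spectrum h"
    using cstar_spectrum_selfadjoint_real[OF sh] by fastforce
  then obtain k where k: "inverses (h - (- 1 - \<i>) *\<^sub>C 1) k"
    by (auto simp: cstar_spectrum_iff)
  define H where "H = h + 1 + \<i> *\<^sub>C 1"
  have H: "h - (- 1 - \<i>) *\<^sub>C 1 = H" by (simp add: H_def scaleC_simps)
  have Hk: "k * H = 1" "H * k = 1" using k unfolding H inverses_def by auto
  have Hks: "star H * star k = 1" "star k * star H = 1"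
    by (metis Hk star_mult star_one)+
  have sH: "star H = h + 1 - \<i> *\<^sub>C 1"
    by (simp add: H_def star_add star_scaleC sh scaleC_simps)
  have comm: "k * h = h * k" "star k * h = h * star k" "star k * k = k * star k"
  proof -
    have "inverses H k" "inverses (star H) (star k)" using Hk Hks by (auto simp: inverses_def)
    moreover have "H * h = h * H" "star H * h = h * star H" "star H * k = k * star H"
    proof -
      show "H * h = h * H" by (simp add: H_def algebra_simps scaleC_simps)
      hence "k * h = h * k" using inverses_commute \<open>inverses H k\<close> by blast
      thus "star H * k = k * star H" by (simp add: sH algebra_simps scaleC_simps)
      show "star H * h = h * star H" unfolding sH by (simp add: algebra_simps scaleC_simps)
    qed
    ultimately show "k * h = h * k" "star k * h = h * star k" "star k * k = k * star k"
      using inverses_commute by blast+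
  qed
  define R where "R = star k * k"
  have hR: "h * R = R * h" by (simp add: R_def mult.assoc comm) (simp add: comm flip: mult.assoc)
  have "star H * H * R = star H * (H * k) * star k"
    by (simp add: R_def comm(3) mult.assoc)
  hence 1: "star H * H * R = 1" using Hk Hks by simp
  have 2: "star H * H = h * h + 2 *\<^sub>R h + 2 *\<^sub>R 1"
    unfolding sH by (simp add: H_def algebra_simps scaleC_simps scaleR_2)
  have hhR: "h * (h * R) = 1 - 2 *\<^sub>R (h * R) - 2 *\<^sub>R R"
    using 1 unfolding 2 by (simp add: algebra_simps)
  define b where "b = a * k"
  have bb: "star b * b = h * R"
  proof -
    have "star b * b = star k * h * k" by (simp add: b_def h_def star_mult mult.assoc)
    thus ?thesis by (simp add: comm R_def mult.assoc)
  qed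
  \<comment> \<open>For real x, |x - 1 + i|^2 = |x + 1 + i|^2 - 4 x. So \<open>n = u k\<close> is
    normal with \<open>star n * n = 1 - 4 h R\<close>, and the bound 1/4 on \<open>h R\<close>
    follows from positivity of \<open>star n * n + n * star n\<close>, which is already
    available.\<close>
  define u where "u = h - 1 + \<i> *\<^sub>C 1"
  have su: "star u = h - 1 - \<i> *\<^sub>C 1"
    by (simp add: u_def star_add star_diff star_scaleC sh scaleC_simps)
  have uR: "R * u = u * R" "k * u = u * k"
    by (simp_all add: u_def algebra_simps scaleC_simps comm hR)
  have suR: "R * star u = star u * R"
    unfolding su by (simp add: algebra_simps scaleC_simps hR)
  have uu: "star u * u = h * h - 2 *\<^sub>R h + 2 *\<^sub>R 1" "u * star u = h * h - 2 *\<^sub>R h + 2 *\<^sub>R 1"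
    unfolding su by (simp_all add: u_def algebra_simps scaleC_simps scaleR_2)
  have uuR: "(h * h - 2 *\<^sub>R h + 2 *\<^sub>R 1) * R = 1 - 4 *\<^sub>R (h * R)"
    by (simp add: algebra_simps hhR) (simp flip: scaleR_add_left)
  define n where "n = u * k"
  have nn: "star n * n = 1 - 4 *\<^sub>R (h * R)" "n * star n = 1 - 4 *\<^sub>R (h * R)"
  proof -
    have "star (k * u) * (k * u) = star u * (R * u)"
      by (simp add: star_mult R_def mult.assoc)
    also have "\<dots> = star u * u * R" by (simp only: uR mult.assoc)
    finally show "star n * n = 1 - 4 *\<^sub>R (h * R)" by (simp add: n_def uR uu uuR)
    have "n * star n = u * (R * star u)"
      by (simp add: n_def star_mult R_def comm(3) mult.assoc)
    also have "\<dots> = u * star u * R" by (simp only: suR mult.assoc)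
    finally show "n * star n = 1 - 4 *\<^sub>R (h * R)" by (simp add: uu uuR)
  qed
  have "cstar_positive (star n * n + n * star n)"
    by (rule cstar_positive_star_mult_add)
  hence "cstar_positive ((1/8) *\<^sub>R (star n * n + n * star n))"
    by (intro cstar_positive_scaleR) auto
  also have "(1/8) *\<^sub>R (star n * n + n * star n) = (1/4) *\<^sub>R 1 - star b * b"
    unfolding nn bb by (simp add: algebra_simps flip: scaleR_add_left)
  finally have le: "cstar_positive ((1/4) *\<^sub>R 1 - star b * b)" .
  have "cstar_positive ((1/4) *\<^sub>R 1 - b * star b)"
    unfolding cstar_positive_def
  proof (intro conjI subsetI)
    show "star ((1/4) *\<^sub>R 1 - b * star b) = (1/4) *\<^sub>R 1 - b * star b"
      by (simp add: star_diff star_scaleR star_mult star_star)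
    fix z assume z: "z \<in> cstar_spectrum ((1/4) *\<^sub>R 1 - b * star b)"
    \<comment> \<open>Swapping \<open>b\<close> and \<open>star b\<close> preserves the nonzero
      spectral points; the exceptional point 0 corresponds to \<open>z = 1/4\<close>, which is
      nonnegative anyway.\<close>
    show "z \<in> complex_of_real ` {0..}"
    proof (cases "z = 1/4")
      case True
      hence "z = complex_of_real (1/4)" by simp
      thus ?thesis by (metis atLeast_iff image_eqI zero_le_divide_1_iff zero_le_numeral)
    next
      case False
      have "1/4 - z \<in> cstar_spectrum (b * star b)"
        by (rule cstar_spectrum_transfer[OF z, of _ _ "-1"])
          (simp_all add: scaleC_simps scaleR_scaleC)
      from cstar_spectrum_mult_commute[OF this] False
      have "1/4 - z \<in> cstar_spectrum (star b * b)" by simp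
      hence "z \<in> cstar_spectrum ((1/4) *\<^sub>R 1 - star b * b)"
        by (rule cstar_spectrum_transfer[where q = "-1"]) (simp_all add: scaleC_simps scaleR_scaleC)
      thus ?thesis using le unfolding cstar_positive_def by blast
    qed
  qed
  from cstar_positive_add[OF this cstar_positive_star_mult_add[of b]]
  have pos: "cstar_positive ((1/4) *\<^sub>R 1 + h * R)" by (simp add: bb)
  \<comment> \<open>The function x / ((x + 1)^2 + 1) fixes -1; algebraically,
    \<open>h R + 1 = (h + 1) (h + 2) R\<close>.\<close>
  have "- 1 \<in> cstar_spectrum (h * R)"
  proof (rule cstar_spectrum_transfer[OF m1])
    show "h * R - (- 1) *\<^sub>C 1 = (h - (- 1) *\<^sub>C 1) * ((h + 2 *\<^sub>R 1) * R)"
      by (simp add: algebra_simps scaleC_simps hhR)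
    show "h * ((h + 2 *\<^sub>R 1) * R) = (h + 2 *\<^sub>R 1) * R * h"
      by (simp only: mult.assoc flip: hR) (simp add: algebra_simps)
  qed
  hence "- (3/4) \<in> cstar_spectrum ((1/4) *\<^sub>R 1 + h * R)"
    by (rule cstar_spectrum_transfer[where q = 1])
      (simp_all add: scaleC_simps scaleR_scaleC algebra_simps flip: scaleC_add_left)
  then obtain r where "- (3/4) = complex_of_real r" "r \<ge> 0"
    using pos by (auto simp: cstar_positive_def)
  moreover from this(1) have "r = - (3/4)" by (auto dest: arg_cong[of _ _ Re])
  ultimately show False by simp
qed

text \<open>Rescaling \<open>a\<close> by a positive real moves any negative spectral point to -1,
  the case already excluded.\<close>

theorem cstar_positive_star_mult:
  fixes a :: "'a::unital_cstar_algebra"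
  shows "cstar_positive (star a * a)"
  unfolding cstar_positive_def
proof (intro conjI subsetI)
  show sa: "star (star a * a) = star a * a" by (simp add: star_mult star_star)
  fix z assume z: "z \<in> cstar_spectrum (star a * a)"
  have im: "Im z = 0" by (rule cstar_spectrum_selfadjoint_real[OF sa z])
  have "Re z \<ge> 0"
  proof (rule ccontr)
    assume neg: "\<not> Re z \<ge> 0"
    define r where "r = 1 / sqrt (- Re z)"
    have r: "r * r * Re z = - 1" using neg by (simp add: r_def)
    hence "complex_of_real (r * r) * z = - 1"
      using im by (auto simp: complex_eq_iff)
    moreover have "star (r *\<^sub>R a) * (r *\<^sub>R a) = complex_of_real (r * r) *\<^sub>C (star a * a)"
      by (simp add: star_scaleR del: of_real_mult flip: scaleR_scaleC)
    hence "complex_of_real (r * r) * z \<in> cstar_spectrum (star (r *\<^sub>R a) * (r *\<^sub>R a))"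
      by (intro cstar_spectrum_transfer[OF z, where q = "complex_of_real (r * r) *\<^sub>C 1"])
        (simp_all add: scaleC_simps algebra_simps)
    ultimately show False using minus_one_notin_spectrum_star_mult[of "r *\<^sub>R a"] by simp
  qed
  moreover have "z = complex_of_real (Re z)" using im by (simp add: complex_eq_iff)
  ultimately show "z \<in> complex_of_real ` {0..}" by (metis atLeast_iff image_eqI)
qed

section \<open>Square roots and Cauchy-Schwarz with values in the algebra\<close>

lemma cstar_positive_mult_star: "cstar_positive (a * star a)"
  using cstar_positive_star_mult[of "star a"] by (simp add: star_star)

lemma star_power_series:
  fixes x :: "'a::unital_cstar_algebra"
  assumes "star x = x" "(\<lambda>n. c n *\<^sub>R x ^ n) sums e"
  shows "star e = e"
proof -
  have "star (x ^ n) = x ^ n" for n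
    by (induction n) (simp_all add: star_mult assms(1) power_commutes)
  hence "(\<lambda>n. star (c n *\<^sub>R x ^ n)) = (\<lambda>n. c n *\<^sub>R x ^ n)"
    by (simp add: star_scaleR)
  thus ?thesis
    using bounded_linear.sums[OF bounded_linear_star assms(2)] assms(2) sums_unique2 by metis
qed

text \<open>The perturbation \<open>e\<close> forces \<open>norm x < 1\<close>, where the series
  converges; a square root of \<open>1 - x\<close> is then \<open>1 - x\<close> times the inverse
  square root.\<close>

lemma cstar_positive_perturbed_sqrt:
  fixes p :: "'a::unital_cstar_algebra"
  assumes "cstar_positive p" "0 < e"
  obtains d where "star d = d" "d * d = p + e *\<^sub>R 1"
proof -
  define t where "t = norm p + e"
  have t: "t > 0" using assms(2) by (simp add: t_def add_nonneg_pos)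
  define x where "x = (1 / t) *\<^sub>R (norm p *\<^sub>R 1 - p)"
  have "t *\<^sub>R x = norm p *\<^sub>R 1 - p" using t by (simp add: x_def)
  hence x1: "t *\<^sub>R (1 - x) = p + e *\<^sub>R 1"
    by (simp add: scaleR_diff_right) (simp add: t_def scaleR_add_left)
  have "norm x = norm (norm p *\<^sub>R 1 - p) / t" using t by (simp add: x_def)
  also have "\<dots> \<le> norm p / t"
    using t assms(1) by (intro divide_right_mono norm_if_cstar_positive) auto
  also have "\<dots> < 1" using t assms(2) by (simp add: t_def)
  finally obtain s where s: "(\<lambda>n. isqrt_coeff n *\<^sub>R x ^ n) sums s" "inverses (1 - x) (s * s)"
    "\<And>y. x * y = y * x \<Longrightarrow> s * y = y * s"
    by (rule inverse_sqrt_series) metis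
  have sx: "star x = x"
    using assms(1) by (simp add: x_def star_scaleR star_diff cstar_positive_selfadjoint)
  have ss: "star s = s" by (rule star_power_series[OF sx s(1)])
  have comm: "s * (1 - x) = (1 - x) * s" by (rule s(3)) (simp add: algebra_simps)
  show thesis
  proof (rule that[of "sqrt t *\<^sub>R ((1 - x) * s)"])
    show "star (sqrt t *\<^sub>R ((1 - x) * s)) = sqrt t *\<^sub>R ((1 - x) * s)"
      by (simp add: star_scaleR star_mult star_diff sx ss comm)
    have "(1 - x) * s * ((1 - x) * s) = (1 - x) * ((1 - x) * (s * s))"
      by (metis comm mult.assoc)
    also have "\<dots> = 1 - x" using s(2) by (simp add: inverses_def)
    finally show "sqrt t *\<^sub>R ((1 - x) * s) * (sqrt t *\<^sub>R ((1 - x) * s)) = p + e *\<^sub>R 1"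
      using t by (simp add: x1)
  qed
qed

text \<open>With \<open>d\<close> a root of \<open>p\<close> plus a small multiple of 1, the
  conjugate is \<open>(c * d) * star (c * d)\<close>; closedness of the cone removes the
  perturbation.\<close>

lemma cstar_positive_conj:
  fixes p :: "'a::unital_cstar_algebra"
  assumes "cstar_positive p"
  shows "cstar_positive (c * p * star c)"
proof (rule cstar_positive_tendsto)
  have "(\<lambda>n. c * (p + (1 / real (Suc n)) *\<^sub>R 1) * star c) \<longlonglongrightarrow> c * (p + 0 *\<^sub>R 1) * star c"
    by (intro tendsto_intros LIMSEQ_inverse_real_of_nat[unfolded inverse_eq_divide])
  thus "(\<lambda>n. c * (p + (1 / real (Suc n)) *\<^sub>R 1) * star c) \<longlonglongrightarrow> c * p * star c" by simp
  fix n
  obtain d where d: "star d = d" "d * d = p + (1 / real (Suc n)) *\<^sub>R 1"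
    using cstar_positive_perturbed_sqrt[OF assms, of "1 / real (Suc n)"] by auto
  have "(c * d) * star (c * d) = c * (d * d) * star c"
    by (simp only: star_mult d(1) mult.assoc)
  thus "cstar_positive (c * (p + (1 / real (Suc n)) *\<^sub>R 1) * star c)"
    using cstar_positive_mult_star[of "c * d"] d(2) by simp
qed simp

text \<open>The hypothesis says that a positive sesquilinear form is positive at \<open>y - t c x\<close>, where
  \<open>p\<close>, \<open>c\<close> and \<open>q\<close> are its values at \<open>(x, x)\<close>, \<open>(y, x)\<close> and \<open>(y, y)\<close>.\<close>
lemma cstar_Cauchy_Schwarz:
  fixes p q c :: "'a::unital_cstar_algebra"
  assumes p: "cstar_positive p"
    and pos: "\<And>t::real. cstar_positive (q - (2 * t) *\<^sub>R (c * star c) + t\<^sup>2 *\<^sub>R (c * p * star c))"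
  shows "(norm c)\<^sup>2 \<le> norm p * norm q"
proof -
  have *: "(norm c)\<^sup>2 \<le> P * norm q" if P: "norm p < P" for P
  proof -
    have P0: "0 < P" using P norm_ge_zero[of p] by linarith
    \<comment> \<open>This \<open>t\<close> minimises \<open>t^2 P - 2 t\<close>; the minimum
      \<open>- 1 / P\<close> is what bounds \<open>c * star c\<close> by \<open>P\<close> times
      \<open>q\<close>.\<close>
    define t where "t = 1 / P"
    have t: "t > 0" "t\<^sup>2 * P = t" using P0 by (simp_all add: t_def power2_eq_square)
    have "cstar_positive (P *\<^sub>R 1 - p)"
      by (intro cstar_positive_norm_diff cstar_positive_selfadjoint p less_imp_le P)
    hence "cstar_positive (t\<^sup>2 *\<^sub>R (c * (P *\<^sub>R 1 - p) * star c))"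
      by (intro cstar_positive_scaleR cstar_positive_conj) auto
    also have "t\<^sup>2 *\<^sub>R (c * (P *\<^sub>R 1 - p) * star c) =
        (t\<^sup>2 * P) *\<^sub>R (c * star c) - t\<^sup>2 *\<^sub>R (c * p * star c)"
      by (simp add: left_diff_distrib right_diff_distrib scaleR_diff_right)
    also note t(2)
    finally have "cstar_positive (t *\<^sub>R (c * star c) - t\<^sup>2 *\<^sub>R (c * p * star c))" .
    from cstar_positive_add[OF pos[of t] this]
    have "cstar_positive (q - t *\<^sub>R (c * star c))"
      by (simp only: mult_2 scaleR_add_left) (simp add: algebra_simps)
    moreover have "cstar_positive (t *\<^sub>R (c * star c))"
      using t(1) by (intro cstar_positive_scaleR cstar_positive_mult_star) auto
    ultimately have "norm (t *\<^sub>R (c * star c)) \<le> norm q"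
      by (intro norm_mono_cstar_positive)
    moreover have "norm (c * star c) = (norm c)\<^sup>2"
      using cstar_identity[of "star c"] by (simp add: star_star norm_star)
    ultimately show ?thesis using P0 by (simp add: t_def field_simps)
  qed
  show ?thesis
  proof (cases "norm q = 0")
    case True
    thus ?thesis using *[of "norm p + 1"] by simp
  next
    case False
    hence q: "norm q > 0" by (simp only: norm_ge_zero order_less_le) simp
    have "(norm c)\<^sup>2 / norm q \<le> norm p"
      by (rule dense_ge) (use * q in \<open>auto simp: field_simps\<close>)
    thus ?thesis using q by (simp add: field_simps)
  qed
qed

text \<open>Here \<open>p\<close>, \<open>c\<close> and \<open>q\<close> are values of the standard
  inner product on finite families, and positivity is tested at the family
  \<open>b i - t c a i\<close>.\<close>

lemma cstar_Cauchy_Schwarz_sum: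
  fixes a b :: "'i \<Rightarrow> 'a::unital_cstar_algebra"
  shows "(norm (\<Sum>i\<in>I. b i * star (a i)))\<^sup>2 \<le>
    norm (\<Sum>i\<in>I. a i * star (a i)) * norm (\<Sum>i\<in>I. b i * star (b i))"
proof -
  define p where "p = (\<Sum>i\<in>I. a i * star (a i))"
  define c where "c = (\<Sum>i\<in>I. b i * star (a i))"
  define q where "q = (\<Sum>i\<in>I. b i * star (b i))"
  have sc: "star c = (\<Sum>i\<in>I. a i * star (b i))"
    using linear_sum[OF bounded_linear.linear[OF bounded_linear_star], of "\<lambda>i. b i * star (a i)" I]
    by (simp add: c_def star_mult star_star)
  have "(norm c)\<^sup>2 \<le> norm p * norm q"
  proof (rule cstar_Cauchy_Schwarz)
    show "cstar_positive p"
      unfolding p_def by (intro cstar_positive_sum cstar_positive_mult_star)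
    fix t :: real
    have "cstar_positive (\<Sum>i\<in>I. (b i - t *\<^sub>R (c * a i)) * star (b i - t *\<^sub>R (c * a i)))"
      by (intro cstar_positive_sum cstar_positive_mult_star)
    also have "(\<Sum>i\<in>I. (b i - t *\<^sub>R (c * a i)) * star (b i - t *\<^sub>R (c * a i))) =
        (\<Sum>i\<in>I. b i * star (b i) - t *\<^sub>R (b i * star (a i) * star c)
          - t *\<^sub>R (c * (a i * star (b i))) + t\<^sup>2 *\<^sub>R (c * (a i * star (a i)) * star c))"
      by (intro sum.cong refl)
        (simp add: star_diff star_scaleR star_mult left_diff_distrib right_diff_distrib
          scaleR_diff_right power2_eq_square mult.assoc)
    also have "\<dots> = q - t *\<^sub>R (c * star c) - t *\<^sub>R (c * star c) + t\<^sup>2 *\<^sub>R (c * p * star c)"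
    proof -
      have "(\<Sum>i\<in>I. t *\<^sub>R (b i * star (a i) * star c)) = t *\<^sub>R (c * star c)"
        by (simp only: c_def sum_distrib_right scaleR_right.sum)
      moreover have "(\<Sum>i\<in>I. t *\<^sub>R (c * (a i * star (b i)))) = t *\<^sub>R (c * star c)"
        by (simp only: sc sum_distrib_left scaleR_right.sum)
      moreover have "(\<Sum>i\<in>I. t\<^sup>2 *\<^sub>R (c * (a i * star (a i)) * star c)) = t\<^sup>2 *\<^sub>R (c * p * star c)"
        by (simp only: p_def sum_distrib_left sum_distrib_right scaleR_right.sum)
      ultimately show ?thesis
        by (simp only: sum.distrib sum_subtractf q_def)
    qed
    also have "\<dots> = q - (2 * t) *\<^sub>R (c * star c) + t\<^sup>2 *\<^sub>R (c * p * star c)"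
      by (simp only: mult_2 scaleR_add_left diff_diff_eq)
    finally show "cstar_positive (q - (2 * t) *\<^sub>R (c * star c) + t\<^sup>2 *\<^sub>R (c * p * star c))" .
  qed
  thus ?thesis by (simp add: p_def c_def q_def)
qed

subsection \<open>The algebra of bounded operators\<close>

text \<open>Packing the endomorphisms into a type of their own lets the series lemma
  \<open>inverse_sqrt_series\<close> apply to them as well as to the coefficient algebra.\<close>
typedef (overloaded) 'v endo = "UNIV :: ('v::real_normed_vector \<Rightarrow>\<^sub>L 'v) set"
  by simp

setup_lifting type_definition_endo

instantiation endo :: (real_normed_vector) real_normed_vector
begin

lift_definition zero_endo :: "'a endo" is "0 :: 'a \<Rightarrow>\<^sub>L 'a" .
lift_definition plus_endo :: "'a endo \<Rightarrow> 'a endo \<Rightarrow> 'a endo" is "(+)" .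
lift_definition minus_endo :: "'a endo \<Rightarrow> 'a endo \<Rightarrow> 'a endo" is "(-)" .
lift_definition uminus_endo :: "'a endo \<Rightarrow> 'a endo" is "uminus" .
lift_definition scaleR_endo :: "real \<Rightarrow> 'a endo \<Rightarrow> 'a endo" is "(*\<^sub>R)" .
lift_definition norm_endo :: "'a endo \<Rightarrow> real" is "norm" .
lift_definition sgn_endo :: "'a endo \<Rightarrow> 'a endo" is "sgn" .
lift_definition dist_endo :: "'a endo \<Rightarrow> 'a endo \<Rightarrow> real" is "dist" .
definition uniformity_endo :: "('a endo \<times> 'a endo) filter" where
  "uniformity_endo = (INF e\<in>{0<..}. principal {(x, y). dist x y < e})"
definition open_endo :: "'a endo set \<Rightarrow> bool" where
  "open_endo U = (\<forall>x\<in>U. \<forall>\<^sub>F (x', y) in uniformity. x' = x \<longrightarrow> y \<in> U)"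

instance
proof
  show "norm (x + y) \<le> norm x + norm y" for x y :: "'a endo"
    by transfer (rule norm_triangle_ineq)
qed ((transfer; simp add: algebra_simps dist_norm sgn_div_norm; fail)
    | simp add: uniformity_endo_def open_endo_def)+

end

instantiation endo :: (real_normed_vector) "{real_normed_algebra, monoid_mult}"
begin

lift_definition one_endo :: "'a endo" is "id_blinfun :: 'a \<Rightarrow>\<^sub>L 'a" .
lift_definition times_endo :: "'a endo \<Rightarrow> 'a endo \<Rightarrow> 'a endo" is "(o\<^sub>L)" .

instance
proof
  show "norm (x * y) \<le> norm x * norm y" for x y :: "'a endo"
    by transfer (rule norm_blinfun_compose)
qed (transfer; auto simp: blinfun.bilinear_simps intro!: blinfun_eqI)+

end

lift_definition apply_endo :: "'v::real_normed_vector endo \<Rightarrow> 'v \<Rightarrow> 'v" is blinfun_apply .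

instance endo :: (banach) banach
proof
  fix X :: "nat \<Rightarrow> 'a endo" assume "Cauchy X"
  hence "Cauchy (\<lambda>n. Rep_endo (X n))"
    by (simp add: Cauchy_def dist_endo.rep_eq)
  then obtain L where "(\<lambda>n. Rep_endo (X n)) \<longlonglongrightarrow> L"
    using convergent_eq_Cauchy by blast
  hence "X \<longlonglongrightarrow> Abs_endo L"
    by (simp add: tendsto_iff dist_endo.rep_eq Abs_endo_inverse)
  thus "convergent X" by (rule convergentI)
qed

lemma apply_endo_simps:
  "apply_endo 0 x = 0" "apply_endo 1 x = x" "apply_endo (A + B) x = apply_endo A x + apply_endo B x"
  "apply_endo (A - B) x = apply_endo A x - apply_endo B x"
  "apply_endo (A * B) x = apply_endo A (apply_endo B x)"
  "apply_endo (r *\<^sub>R A) x = r *\<^sub>R apply_endo A x"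
  by (transfer; simp add: blinfun.bilinear_simps)+

lemma bounded_linear_apply_endo_left: "bounded_linear (\<lambda>A. apply_endo A x)"
proof (rule bounded_linear_intro)
  show "norm (apply_endo A x) \<le> norm A * norm x" for A
    by transfer (rule norm_blinfun)
qed (simp_all add: apply_endo_simps)

lemma endo_of_bounded_linear:
  fixes T :: "'v::real_normed_vector \<Rightarrow> 'v"
  assumes "linear T" "\<And>x. norm (T x) \<le> q * norm x" "0 \<le> q"
  obtains A where "\<And>x. apply_endo A x = T x" "norm A \<le> q"
proof
  have bl: "bounded_linear T"
    by (rule bounded_linear.intro[OF assms(1)], unfold_locales)
      (use assms(2) in \<open>metis mult.commute\<close>)
  show "apply_endo (Abs_endo (Blinfun T)) x = T x" for x
    by (simp add: apply_endo.rep_eq Abs_endo_inverse bounded_linear_Blinfun_apply[OF bl])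
  show "norm (Abs_endo (Blinfun T)) \<le> q"
    using norm_blinfun_bound[OF assms(3), of "Blinfun T"] assms(2)
    by (simp add: norm_endo.rep_eq Abs_endo_inverse bounded_linear_Blinfun_apply[OF bl])
qed

subsection \<open>Hilbert modules\<close>

context hilbert_module
begin

lemma act_scaleC_one: "act (c *\<^sub>C 1) x = c *\<^sub>C x"
  by (simp add: act_scaleC_left act_one)

lemma act_scaleR_one: "act (r *\<^sub>R 1) x = r *\<^sub>R x"
  by (simp add: act_scaleC_left act_one scaleR_scaleC)

lemma ip_add_right: "ip x (y + z) = ip x y + ip x z"
  by (metis ip_add_left star_add star_ip)

lemma ip_act_right: "ip x (act a y) = ip x y * star a"
  by (metis ip_act_left star_ip star_mult)

lemma ip_scaleC_left: "ip (c *\<^sub>C x) y = c *\<^sub>C ip x y"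
  by (simp add: ip_act_left mult_scaleC_left flip: act_scaleC_one)

lemma ip_scaleC_right: "ip x (c *\<^sub>C y) = cnj c *\<^sub>C ip x y"
  by (metis ip_scaleC_left star_ip star_scaleC)

lemma ip_scaleR_left: "ip (r *\<^sub>R x) y = r *\<^sub>R ip x y"
  by (simp add: ip_scaleC_left scaleR_scaleC)

lemma ip_scaleR_right: "ip x (r *\<^sub>R y) = r *\<^sub>R ip x y"
  by (simp add: ip_scaleC_right scaleR_scaleC)

lemma norm_sq_ip: "(norm x)\<^sup>2 = norm (ip x x)"
  by (simp add: norm_ip)

text \<open>Positivity is tested at \<open>y - t c x\<close> with \<open>c = ip (T y) x\<close>. The
  identity for \<open>T\<close> gives the usual inequality; a general \<open>T\<close> leads to norm
  bounds for positive operators.\<close>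

lemma form_Cauchy_Schwarz:
  assumes add: "\<And>x y. T (x + y) = T x + T y" and act: "\<And>a x. T (act a x) = act a (T x)"
    and sym: "\<And>x y. ip (T x) y = ip x (T y)" and pos: "\<And>x. cstar_positive (ip (T x) x)"
  shows "(norm (ip (T y) x))\<^sup>2 \<le> norm (ip (T x) x) * norm (ip (T y) y)"
proof (rule cstar_Cauchy_Schwarz[OF pos])
  fix t :: real
  let ?c = "ip (T y) x"
  define a where "a = - (t *\<^sub>R ?c)"
  have c: "ip (T x) y = star ?c" by (simp add: star_ip sym)
  have "cstar_positive (ip (T (y + act a x)) (y + act a x))"
    by (rule pos)
  also have "ip (T (y + act a x)) (y + act a x) =
      ip (T y) y + ?c * star a + a * star ?c + a * ip (T x) x * star a"
    by (simp add: add act ip_add_left ip_add_right ip_act_left ip_act_right c algebra_simps)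
  also have "\<dots> = ip (T y) y - (2 * t) *\<^sub>R (?c * star ?c) + t\<^sup>2 *\<^sub>R (?c * ip (T x) x * star ?c)"
    by (simp only: mult_2 scaleR_add_left flip: diff_diff_eq)
      (simp add: a_def star_minus star_scaleR power2_eq_square)
  finally show "cstar_positive
    (ip (T y) y - (2 * t) *\<^sub>R (?c * star ?c) + t\<^sup>2 *\<^sub>R (?c * ip (T x) x * star ?c))" .
qed

lemma norm_ip_le: "norm (ip x y) \<le> norm x * norm y"
proof (rule power2_le_imp_le)
  show "(norm (ip x y))\<^sup>2 \<le> (norm x * norm y)\<^sup>2"
    using form_Cauchy_Schwarz[of "\<lambda>x. x" x y] ip_positive
    by (simp add: power_mult_distrib norm_sq_ip mult.commute)
qed simp

lemma bounded_linear_ip_left: "bounded_linear (\<lambda>x. ip x y)"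
  by (rule bounded_linear_intro[where K = "norm y"])
    (simp_all add: ip_add_left ip_scaleR_left norm_ip_le)

lemma bounded_linear_ip_right: "bounded_linear (\<lambda>y. ip x y)"
  by (rule bounded_linear_intro[where K = "norm x"])
    (use norm_ip_le[of x] in \<open>simp_all add: ip_add_right ip_scaleR_right mult.commute\<close>)

lemma norm_act_le: "norm (act a x) \<le> norm a * norm x"
proof (rule power2_le_imp_le)
  have "norm (ip (act a x) (act a x)) \<le> norm a * norm (ip x x) * norm a"
    unfolding ip_act_left ip_act_right
    by (metis (no_types, opaque_lifting) mult.assoc norm_mult_ineq norm_star mult_left_mono
        norm_ge_zero order_trans)
  thus "(norm (act a x))\<^sup>2 \<le> (norm a * norm x)\<^sup>2"
    by (simp add: norm_sq_ip power_mult_distrib) (simp add: power2_eq_square mult_ac)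
qed simp

lemma bounded_linear_act: "bounded_linear (act a)"
  by (rule bounded_linear_intro[where K = "norm a"])
    (use norm_act_le[of a] in \<open>simp_all add: act_add_right act_scaleC_right scaleR_scaleC mult.commute\<close>)

text \<open>Cauchy-Schwarz for the form of \<open>T\<close> at the pair \<open>x\<close>,
  \<open>T x\<close> bounds the fourth power of \<open>norm (T x)\<close> by \<open>q^2\<close>
  times the squares of \<open>norm (T x)\<close> and \<open>norm x\<close>.\<close>

lemma positive_form_norm_le:
  assumes add: "\<And>x y. T (x + y) = T x + T y" and act: "\<And>a x. T (act a x) = act a (T x)"
    and sym: "\<And>x y. ip (T x) y = ip x (T y)" and pos: "\<And>x. cstar_positive (ip (T x) x)"
    and le: "\<And>x. cstar_positive (q *\<^sub>R ip x x - ip (T x) x)" and q: "0 \<le> q"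
  shows "norm (T x) \<le> q * norm x"
proof (cases "norm (T x) = 0")
  case False
  have *: "norm (ip (T z) z) \<le> q * (norm z)\<^sup>2" for z
    using norm_mono_cstar_positive[OF pos le, of z] q by (simp add: norm_sq_ip)
  have "((norm (T x))\<^sup>2)\<^sup>2 \<le> norm (ip (T (T x)) (T x)) * norm (ip (T x) x)"
    using form_Cauchy_Schwarz[OF add act sym pos, of x "T x"] by (simp add: norm_sq_ip)
  also have "\<dots> \<le> (q * (norm (T x))\<^sup>2) * (q * (norm x)\<^sup>2)"
    using q by (intro mult_mono *) auto
  also have "\<dots> = (q * norm x * norm (T x))\<^sup>2" by (simp add: power2_eq_square)
  finally have "(norm (T x))\<^sup>2 \<le> q * norm x * norm (T x)"
    by (rule power2_le_imp_le) (use q in simp)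
  thus ?thesis using False by (simp add: power2_eq_square)
qed (use q in simp)

end

subsection \<open>The frame operator\<close>

text \<open>Frame sums need not converge absolutely, so the Cauchy criterion is applied to the net
  of finite sets: the increment of \<open>h\<close> over \<open>A - F0\<close> is controlled by that
  of \<open>g\<close>.\<close>

lemma summable_on_dominated_sq:
  fixes g :: "'i \<Rightarrow> 'a::real_normed_vector" and h :: "'i \<Rightarrow> 'b::banach"
  assumes g: "g summable_on I" and K: "0 < K"
    and le: "\<And>F. finite F \<Longrightarrow> F \<subseteq> I \<Longrightarrow> (norm (sum h F))\<^sup>2 \<le> K * norm (sum g F)"
  shows "h summable_on I"
proof -
  have "\<exists>P. eventually P (finite_subsets_at_top I) \<and>
      (\<forall>A B. P A \<and> P B \<longrightarrow> dist (sum h A) (sum h B) < e)" if e: "e > 0" for e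
  proof -
    \<comment> \<open>Two partial sums of \<open>g\<close> within \<open>d\<close> of the limit
      differ by less than \<open>2 d\<close>, and \<open>K\<close> times \<open>2 d\<close> is the
      square of \<open>e / 2\<close>.\<close>
    define d where "d = (e / 2)\<^sup>2 / (2 * K)"
    have d: "d > 0" using e K by (simp add: d_def)
    from tendstoD[OF infsum_tendsto[OF g] d] obtain F0 where F0: "finite F0" "F0 \<subseteq> I"
      "\<And>F. finite F \<Longrightarrow> F0 \<subseteq> F \<Longrightarrow> F \<subseteq> I \<Longrightarrow> dist (sum g F) (infsum g I) < d"
      by (auto simp: eventually_finite_subsets_at_top)
    have *: "norm (sum h A - sum h F0) < e / 2" if A: "finite A" "F0 \<subseteq> A" "A \<subseteq> I" for A
    proof -
      have "(norm (sum h (A - F0)))\<^sup>2 \<le> K * norm (sum g (A - F0))"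
        using A by (intro le) auto
      also have "norm (sum g (A - F0)) = dist (sum g A) (sum g F0)"
        using A by (simp add: sum_diff dist_norm)
      also have "\<dots> < 2 * d"
        using dist_triangle2[of "sum g A" "sum g F0" "infsum g I"] F0(3)[OF A] F0(3)[OF F0(1) _ F0(2)]
        by simp
      finally have "(norm (sum h (A - F0)))\<^sup>2 < (e / 2)\<^sup>2"
        using K by (simp add: d_def)
      hence "norm (sum h (A - F0)) < e / 2"
        by (rule power2_less_imp_less) (use e in simp)
      thus ?thesis using A by (simp add: sum_diff)
    qed
    define P where "P A \<longleftrightarrow> finite A \<and> F0 \<subseteq> A \<and> A \<subseteq> I" for A
    have "eventually P (finite_subsets_at_top I)"
      unfolding eventually_finite_subsets_at_top P_def using F0 by blast
    moreover have "dist (sum h A) (sum h B) < e" if "P A" "P B" for A B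
      using dist_triangle2[of "sum h A" "sum h B" "sum h F0"] *[of A] *[of B] that
      by (simp add: P_def dist_norm)
    ultimately show ?thesis by blast
  qed
  hence "cauchy_filter (filtermap (sum h) (finite_subsets_at_top I))"
    by (simp add: cauchy_filter_metric_filtermap)
  moreover have "complete (UNIV :: 'b set)"
    by (meson Cauchy_convergent UNIV_I complete_def convergent_def)
  ultimately obtain L where "(sum h \<longlongrightarrow> L) (finite_subsets_at_top I)"
    using complete_uniform[where S = UNIV] by (force simp: filterlim_def)
  thus ?thesis using summable_on_def has_sum_def by blast
qed

context hilbert_module
begin

lemma frame_finite_sum_le:
  assumes f: "standard_frame_bounds C D ip J f" and F: "finite F" "F \<subseteq> J" and D: "0 \<le> D"
  shows "norm (\<Sum>j\<in>F. ip y (f j) * ip (f j) y) \<le> D * (norm y)\<^sup>2"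
proof -
  let ?g = "\<lambda>j. ip y (f j) * ip (f j) y"
  have pos: "cstar_positive (?g j)" for j
    using cstar_positive_mult_star[of "ip y (f j)"] by (simp add: star_ip)
  have g: "?g summable_on J" and le: "cstar_positive (D *\<^sub>R ip y y - infsum ?g J)"
    using f by (auto simp: standard_frame_bounds_def cstar_le_def)
  have "infsum ?g (F \<union> (J - F)) = infsum ?g F + infsum ?g (J - F)"
    using g F by (intro infsum_Un_disjoint) (auto intro: summable_on_subset_banach)
  hence "infsum ?g J = sum ?g F + infsum ?g (J - F)"
    using F by (simp add: Un_absorb1)
  moreover have "cstar_positive (infsum ?g (J - F))"
    by (intro cstar_positive_infsum pos)
  ultimately have "cstar_positive (D *\<^sub>R ip y y - sum ?g F)"
    using cstar_positive_add[OF le, of "infsum ?g (J - F)"] by simp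
  hence "norm (sum ?g F) \<le> norm (D *\<^sub>R ip y y)"
    by (intro norm_mono_cstar_positive cstar_positive_sum pos)
  thus ?thesis using D by (simp add: norm_sq_ip)
qed

text \<open>Synthesis is dual to analysis: expanding \<open>ip y y\<close> and applying
  Cauchy-Schwarz bounds the fourth power of \<open>norm y\<close> by its square times the right-hand
  side, and the square cancels.\<close>

lemma frame_synthesis_norm_le:
  assumes f: "standard_frame_bounds C D ip J f" and F: "finite F" "F \<subseteq> J" and D: "0 \<le> D"
  shows "(norm (\<Sum>j\<in>F. act (c j) (f j)))\<^sup>2 \<le> D * norm (\<Sum>j\<in>F. c j * star (c j))"
proof -
  define y where "y = (\<Sum>j\<in>F. act (c j) (f j))"
  have "ip y y = (\<Sum>j\<in>F. ip (act (c j) (f j)) y)"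
    unfolding y_def by (rule linear_sum[OF bounded_linear.linear[OF bounded_linear_ip_left]])
  also have "\<dots> = (\<Sum>j\<in>F. c j * star (ip y (f j)))"
    by (simp add: ip_act_left star_ip)
  finally have "(norm (ip y y))\<^sup>2 \<le>
      norm (\<Sum>j\<in>F. ip y (f j) * star (ip y (f j))) * norm (\<Sum>j\<in>F. c j * star (c j))"
    using cstar_Cauchy_Schwarz_sum[of c "\<lambda>j. ip y (f j)" F] by simp
  also have "\<dots> \<le> D * (norm y)\<^sup>2 * norm (\<Sum>j\<in>F. c j * star (c j))"
    using frame_finite_sum_le[OF f F D, of y] by (intro mult_right_mono) (auto simp: star_ip)
  finally have *: "(norm y)\<^sup>2 * (norm y)\<^sup>2 \<le> (norm y)\<^sup>2 * (D * norm (\<Sum>j\<in>F. c j * star (c j)))"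
    by (simp add: norm_sq_ip[symmetric] power2_eq_square mult_ac)
  have "(norm y)\<^sup>2 \<le> D * norm (\<Sum>j\<in>F. c j * star (c j))"
  proof (cases "norm y = 0")
    case True
    thus ?thesis using D by simp
  next
    case False
    hence "(norm y)\<^sup>2 > 0" by simp
    thus ?thesis using * by (rule mult_le_cancel_left_pos[THEN iffD1])
  qed
  thus ?thesis by (simp only: y_def)
qed

text \<open>The frame condition controls only the diagonal sums
  \<open>ip x (f j) * ip (f j) x\<close>; the synthesis estimate lifts their convergence to the
  series of vectors.\<close>

lemma frame_operator_exists:
  assumes f: "standard_frame_bounds C D ip J f" and D: "0 < D"
  obtains S where
    "\<And>x y. ((\<lambda>j. ip x (f j) * ip (f j) y) has_sum ip (S x) y) J"
    "\<And>x y. S (x + y) = S x + S y" "\<And>a x. S (act a x) = act a (S x)"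
    "\<And>x y. ip (S x) y = ip x (S y)"
proof -
  define S where "S x = (\<Sum>\<^sub>\<infinity>j\<in>J. act (ip x (f j)) (f j))" for x
  have summable: "(\<lambda>j. act (ip x (f j)) (f j)) summable_on J" for x
  proof (rule summable_on_dominated_sq)
    show "(\<lambda>j. ip x (f j) * ip (f j) x) summable_on J"
      using f by (auto simp: standard_frame_bounds_def)
    show "(norm (\<Sum>j\<in>F. act (ip x (f j)) (f j)))\<^sup>2 \<le> D * norm (\<Sum>j\<in>F. ip x (f j) * ip (f j) x)"
      if "finite F" "F \<subseteq> J" for F
      using frame_synthesis_norm_le[OF f that, of "\<lambda>j. ip x (f j)"] D by (simp add: star_ip)
  qed fact
  have S: "((\<lambda>j. act (ip x (f j)) (f j)) has_sum S x) J" for x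
    unfolding S_def by (rule has_sum_infsum[OF summable])
  have 1: "((\<lambda>j. ip x (f j) * ip (f j) y) has_sum ip (S x) y) J" for x y
    using has_sum_bounded_linear[OF bounded_linear_ip_left S] by (simp add: ip_act_left)
  have 2: "S (x + y) = S x + S y" for x y
    using has_sum_add[OF S[of x] S[of y]] S[of "x + y"]
    by (simp add: ip_add_left act_add_left has_sum_unique)
  have 3: "S (act a x) = act a (S x)" for a x
    using has_sum_bounded_linear[OF bounded_linear_act[of a] S[of x]] S[of "act a x"]
    by (simp add: ip_act_left act_mult has_sum_unique)
  have 4: "ip (S x) y = ip x (S y)" for x y
  proof -
    have "((\<lambda>j. ip x (f j) * ip (f j) y) has_sum ip x (S y)) J"
      using has_sum_bounded_linear[OF bounded_linear_ip_right S] by (simp add: ip_act_right star_ip)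
    thus ?thesis using 1 has_sum_unique by blast
  qed
  show thesis using that 1 2 3 4 by blast
qed

text \<open>With \<open>S = d (1 - A)\<close> and \<open>\<parallel>A\<parallel> < 1\<close>, the operator \<open>W\<close> is the square root of
  \<open>(1 + A) / (1 - A)\<close>.\<close>
lemma complementary_sqrt_exists:
  assumes add: "\<And>x y. S (x + y) = S x + S y" and act: "\<And>a x. S (act a x) = act a (S x)"
    and sym: "\<And>x y. ip (S x) y = ip x (S y)"
    and lower: "\<And>x. cstar_positive (ip (S x) x - C *\<^sub>R ip x x)"
    and upper: "\<And>x. cstar_positive (D *\<^sub>R ip x x - ip (S x) x)"
    and C: "0 < C"
  obtains W d where "0 < d" "\<And>x y. ip (W x) y = ip x (W y)" "\<And>x. S (W x) = W (S x)"
    "\<And>x. S x + W (S (W x)) = (2 * d) *\<^sub>R x"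
proof -
  \<comment> \<open>From \<open>d \<ge> D\<close> the operator \<open>T\<close> is positive; from
    \<open>d \<ge> C\<close> the bound \<open>1 - C / d\<close> is nonnegative even if
    \<open>C > D\<close>, which the zero module allows.\<close>
  define d where "d = max C D"
  have d: "0 < d" "C \<le> d" "D \<le> d" using C by (auto simp: d_def)
  define T where "T x = x - (1 / d) *\<^sub>R S x" for x
  have T_add: "T (x + y) = T x + T y" for x y
    by (simp add: T_def add algebra_simps)
  have act_diff: "act a (x - y) = act a x - act a y" for a x y
    using act_add_right[of a "x - y" y] by simp
  have T_act: "T (act a x) = act a (T x)" for a x
    by (simp add: T_def act act_diff act_scaleC_right scaleR_scaleC)
  have ip_diff: "ip (x - y) z = ip x z - ip y z" "ip z (x - y) = ip z x - ip z y" for x y z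
    by (rule linear_diff[OF bounded_linear.linear[OF bounded_linear_ip_left]],
        rule linear_diff[OF bounded_linear.linear[OF bounded_linear_ip_right]])
  have T_sym: "ip (T x) y = ip x (T y)" for x y
    by (simp add: T_def ip_diff ip_scaleR_left ip_scaleR_right sym)
  have T_pos: "cstar_positive (ip (T x) x)" for x
  proof -
    have "cstar_positive ((1 / d) *\<^sub>R ((d - D) *\<^sub>R ip x x + (D *\<^sub>R ip x x - ip (S x) x)))"
      using d by (intro cstar_positive_scaleR cstar_positive_add upper ip_positive) auto
    also have "(1 / d) *\<^sub>R ((d - D) *\<^sub>R ip x x + (D *\<^sub>R ip x x - ip (S x) x)) = ip (T x) x"
      using d by (simp add: T_def ip_diff ip_scaleR_left scaleR_diff_left scaleR_diff_right)
    finally show ?thesis .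
  qed
  have T_le: "cstar_positive ((1 - C / d) *\<^sub>R ip x x - ip (T x) x)" for x
  proof -
    have "cstar_positive ((1 / d) *\<^sub>R (ip (S x) x - C *\<^sub>R ip x x))"
      using d by (intro cstar_positive_scaleR lower) auto
    also have "(1 / d) *\<^sub>R (ip (S x) x - C *\<^sub>R ip x x) = (1 - C / d) *\<^sub>R ip x x - ip (T x) x"
      by (simp add: T_def ip_diff ip_scaleR_left scaleR_diff_left scaleR_diff_right)
    finally show ?thesis .
  qed
  have q: "0 \<le> 1 - C / d" using d by simp
  have T_norm: "norm (T x) \<le> (1 - C / d) * norm x" for x
    by (rule positive_form_norm_le[OF T_add T_act T_sym T_pos T_le q])
  have "linear T"
  proof (rule linearI[OF T_add])
    show "T (r *\<^sub>R x) = r *\<^sub>R T x" for r x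
      using T_act[of "r *\<^sub>R 1" x] by (simp add: act_scaleR_one)
  qed
  then obtain A where A: "\<And>x. apply_endo A x = T x" "norm A \<le> 1 - C / d"
    using endo_of_bounded_linear[OF _ T_norm] q by blast
  have "norm A < 1" using A(2) divide_pos_pos[OF C d(1)] by linarith
  hence "norm A * norm A < 1" using mult_strict_mono[of "norm A" 1 "norm A" 1] by simp
  hence "norm (A * A) < 1" using norm_mult_ineq order_le_less_trans by blast
  then obtain e where e: "(\<lambda>n. isqrt_coeff n *\<^sub>R (A * A) ^ n) sums e"
    "inverses (1 - A * A) (e * e)" "\<And>y. A * A * y = y * (A * A) \<Longrightarrow> e * y = y * e"
    by (rule inverse_sqrt_series) metis
  have eA: "e * A = A * e" by (rule e(3)) (simp add: mult.assoc)
  \<comment> \<open>The type \<open>endo\<close> carries no involution, so symmetry is verified on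
    the powers and passed to the limit by continuity of \<open>ip\<close>.\<close>
  have e_sym: "ip (apply_endo e x) y = ip x (apply_endo e y)" for x y
  proof -
    have "ip (apply_endo ((A * A) ^ n) x) y = ip x (apply_endo ((A * A) ^ n) y)" for n x y
    proof (induction n arbitrary: x y)
      case (Suc n)
      have "ip (apply_endo ((A * A) ^ Suc n) x) y = ip x (apply_endo ((A * A) ^ n * (A * A)) y)"
        by (simp add: apply_endo_simps A(1) T_sym Suc.IH)
      thus ?case by (simp only: power_Suc2)
    qed (simp add: apply_endo_simps)
    hence eq: "(\<lambda>n. ip (apply_endo (isqrt_coeff n *\<^sub>R (A * A) ^ n) x) y) =
        (\<lambda>n. ip x (apply_endo (isqrt_coeff n *\<^sub>R (A * A) ^ n) y))"
      by (simp add: apply_endo_simps ip_scaleR_left ip_scaleR_right)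
    have "(\<lambda>n. ip (apply_endo (isqrt_coeff n *\<^sub>R (A * A) ^ n) x) y) sums ip (apply_endo e x) y"
      by (rule bounded_linear.sums[OF bounded_linear_ip_left
            bounded_linear.sums[OF bounded_linear_apply_endo_left e(1)]])
    moreover have "(\<lambda>n. ip x (apply_endo (isqrt_coeff n *\<^sub>R (A * A) ^ n) y)) sums ip x (apply_endo e y)"
      by (rule bounded_linear.sums[OF bounded_linear_ip_right
            bounded_linear.sums[OF bounded_linear_apply_endo_left e(1)]])
    ultimately show ?thesis unfolding eq by (rule sums_unique2)
  qed
  \<comment> \<open>Since (1 + A) / (1 - A) = (1 + A)^2 / (1 - A^2), its root is
    \<open>1 + A\<close> times the inverse square root \<open>e\<close> of
    \<open>1 - A * A\<close>.\<close>
  define W where "W = (1 + A) * e"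
  have We: "W = e * (1 + A)" by (simp add: W_def algebra_simps eA)
  have W_sym: "ip (apply_endo W x) y = ip x (apply_endo W y)" for x y
  proof -
    have "ip (apply_endo W x) y = ip (apply_endo e x) (apply_endo (1 + A) y)"
      by (simp add: W_def apply_endo_simps ip_add_left ip_add_right A(1) T_sym)
    also have "\<dots> = ip x (apply_endo W y)"
      by (simp add: We e_sym apply_endo_simps(5))
    finally show ?thesis .
  qed
  have W_comm: "W * (1 - A) = (1 - A) * W"
    by (simp add: W_def algebra_simps eA)
  have "(1 - A) * (W * W) = (1 - A) * ((1 + A) * ((1 + A) * (e * e)))"
    unfolding W_def by (simp add: algebra_simps eA) (metis eA mult.assoc)
  also have "\<dots> = (1 + A) * ((1 - A * A) * (e * e))"
    by (simp add: algebra_simps)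
  also have "\<dots> = 1 + A" using e(2) by (simp add: inverses_def)
  finally have WW: "W * ((1 - A) * W) = 1 + A"
    by (simp only: W_comm flip: mult.assoc)
  have S: "S x = apply_endo (d *\<^sub>R (1 - A)) x" for x
    using d by (simp add: apply_endo_simps A(1) T_def)
  show thesis
  proof (rule that[OF d(1), of "apply_endo W"])
    show "S (apply_endo W x) = apply_endo W (S x)" for x
      by (simp add: S W_comm flip: apply_endo_simps(5))
    show "S x + apply_endo W (S (apply_endo W x)) = (2 * d) *\<^sub>R x" for x
    proof -
      have "S x + apply_endo W (S (apply_endo W x)) =
          apply_endo (d *\<^sub>R (1 - A) + d *\<^sub>R (W * ((1 - A) * W))) x"
        unfolding S by (simp add: apply_endo_simps(3) flip: apply_endo_simps(5))
      also have "d *\<^sub>R (1 - A) + d *\<^sub>R (W * ((1 - A) * W)) = (2 * d) *\<^sub>R 1"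
        unfolding WW mult_2 scaleR_add_left by (simp add: scaleR_diff_right scaleR_add_right)
      finally show ?thesis by (simp add: apply_endo_simps)
    qed
  qed (rule W_sym)
qed

text \<open>The conditions on \<open>s\<close> mean that it is \<open>i\<close> or
  \<open>- i\<close>. Moving \<open>G\<close> to its adjoint \<open>G'\<close> turns the frame sum
  at \<open>x\<close> into \<open>ip (S (G' x)) (G' x)\<close>; there \<open>s + cnj s = 0\<close>
  removes the cross terms, and the rest is \<open>S + W S W\<close>, a multiple of the
  identity.\<close>

lemma tight_frame_of_complementary_sqrt:
  assumes S: "\<And>x y. ((\<lambda>j. ip x (f j) * ip (f j) y) has_sum ip (S x) y) J"
    and S_add: "\<And>x y. S (x + y) = S x + S y" and S_act: "\<And>a x. S (act a x) = act a (S x)"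
    and W_sym: "\<And>x y. ip (W x) y = ip x (W y)" and SW: "\<And>x. S (W x) = W (S x)"
    and WSW: "\<And>x. S x + W (S (W x)) = (2 * d) *\<^sub>R x" and d: "0 < d"
    and s: "s * cnj s = 1" "s + cnj s = 0"
  shows "standard_normalized_tight_frame ip J (\<lambda>j. (1 / sqrt (2 * d)) *\<^sub>R (f j + s *\<^sub>C W (f j)))"
proof -
  define m where "m = 1 / sqrt (2 * d)"
  define G where "G x = m *\<^sub>R (x + s *\<^sub>C W x)" for x
  define G' where "G' x = m *\<^sub>R (x + cnj s *\<^sub>C W x)" for x
  have m: "m * m * (2 * d) = 1" using d by (simp add: m_def)
  have adj: "ip x (G y) = ip (G' x) y" "ip (G y) x = ip y (G' x)" for x y
    by (simp_all add: G_def G'_def ip_scaleR_left ip_scaleR_right ip_add_left ip_add_right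
        ip_scaleC_left ip_scaleC_right W_sym)
  have S_scaleC: "S (c *\<^sub>C x) = c *\<^sub>C S x" for c x
    using S_act[of "c *\<^sub>C 1" x] by (simp add: act_scaleC_one)
  have S_scaleR: "S (r *\<^sub>R x) = r *\<^sub>R S x" for r x
    by (simp add: S_scaleC scaleR_scaleC)
  have "ip (S (G' x)) (G' x) = ip x x" for x
  proof -
    define v where "v = x + cnj s *\<^sub>C W x"
    have "ip (S (G' x)) (G' x) = (m * m) *\<^sub>R ip (S v) v"
      by (simp add: G'_def S_scaleR ip_scaleR_left ip_scaleR_right flip: v_def)
    also have "ip (S v) v = ip (S x) x + cnj s *\<^sub>C ip (S (W x)) x
        + s *\<^sub>C ip (S x) (W x) + (s * cnj s) *\<^sub>C ip (S (W x)) (W x)"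
      by (simp add: v_def S_add S_scaleC ip_add_left ip_add_right ip_scaleC_left ip_scaleC_right
          scaleC_simps algebra_simps)
    also have "ip (S x) (W x) = ip (S (W x)) x" by (simp add: SW flip: W_sym)
    also have "ip (S (W x)) (W x) = ip (W (S (W x))) x" by (simp flip: W_sym)
    also have "ip (S x) x + cnj s *\<^sub>C ip (S (W x)) x + s *\<^sub>C ip (S (W x)) x
        + (s * cnj s) *\<^sub>C ip (W (S (W x))) x
      = ip (S x + W (S (W x))) x + (s + cnj s) *\<^sub>C ip (S (W x)) x"
      unfolding s(1) by (simp add: ip_add_left scaleC_add_left scaleC_one)
    also have "\<dots> = (2 * d) *\<^sub>R ip x x"
      unfolding s(2) WSW by (simp add: ip_scaleR_left)
    finally show ?thesis using m by simp
  qed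
  hence "((\<lambda>j. ip x (G (f j)) * ip (G (f j)) x) has_sum ip x x) J" for x
    using S[of "G' x" "G' x"] by (simp add: adj)
  hence "standard_normalized_tight_frame ip J (\<lambda>j. G (f j))"
    by (auto simp: standard_normalized_tight_frame_def standard_frame_bounds_def cstar_le_def
        has_sum_iff)
  thus ?thesis by (simp only: G_def m_def)
qed

end

theorem theorem7p2:
  fixes act :: "'a::unital_cstar_algebra \<Rightarrow> 'h::complex_banach \<Rightarrow> 'h"
    and ip :: "'h \<Rightarrow> 'h \<Rightarrow> 'a"
    and J :: "'j set"
    and f :: "'j \<Rightarrow> 'h"
  assumes "hilbert_module act ip"
    and "finitely_generated act \<or> countably_generated act"
    and "countable J"
    and "standard_frame ip J f"
  shows "\<exists>(l::complex) g h.
           standard_normalized_tight_frame ip J g \<and>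
           standard_normalized_tight_frame ip J h \<and>
           (\<forall>j\<in>J. f j = l *\<^sub>C (g j + h j))"
proof -
  interpret hilbert_module act ip by fact
  obtain C D where CD: "0 < C" "0 < D" and f: "standard_frame_bounds C D ip J f"
    using assms(4) by (auto simp: standard_frame_def)
  obtain S where S: "\<And>x y. ((\<lambda>j. ip x (f j) * ip (f j) y) has_sum ip (S x) y) J"
    "\<And>x y. S (x + y) = S x + S y" "\<And>a x. S (act a x) = act a (S x)"
    "\<And>x y. ip (S x) y = ip x (S y)"
    by (rule frame_operator_exists[OF f CD(2)]) (rule that)
  have "(\<Sum>\<^sub>\<infinity>j\<in>J. ip x (f j) * ip (f j) x) = ip (S x) x" for x
    using S(1) by (rule infsumI)
  hence bounds: "cstar_positive (ip (S x) x - C *\<^sub>R ip x x)"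
    "cstar_positive (D *\<^sub>R ip x x - ip (S x) x)" for x
    using f by (simp_all add: standard_frame_bounds_def cstar_le_def)
  obtain W d where W: "0 < d" "\<And>x y. ip (W x) y = ip x (W y)" "\<And>x. S (W x) = W (S x)"
    "\<And>x. S x + W (S (W x)) = (2 * d) *\<^sub>R x"
    by (rule complementary_sqrt_exists[OF S(2-4) bounds CD(1)]) (rule that)
  define g where "g s j = (1 / sqrt (2 * d)) *\<^sub>R (f j + s *\<^sub>C W (f j))" for s j
  have tight: "standard_normalized_tight_frame ip J (g s)" if "s * cnj s = 1" "s + cnj s = 0" for s
    unfolding g_def using tight_frame_of_complementary_sqrt[OF S(1-3) W(2-4,1) that] .
  \<comment> \<open>The terms in \<open>W\<close> cancel and leave
    \<open>2 f j / sqrt (2 d)\<close>, which dictates the scalar.\<close>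
  have "f j = complex_of_real (sqrt (2 * d) / 2) *\<^sub>C (g \<i> j + g (- \<i>) j)" for j
  proof -
    have "f j + \<i> *\<^sub>C W (f j) + (f j + (- \<i>) *\<^sub>C W (f j)) = 2 *\<^sub>R f j"
      by (subst scaleR_2) (simp add: scaleC_minus_left)
    hence "g \<i> j + g (- \<i>) j = (1 / sqrt (2 * d)) *\<^sub>R (2 *\<^sub>R f j)"
      by (simp only: g_def flip: scaleR_add_right)
    thus ?thesis using W(1) by (simp only: scaleR_scaleC[symmetric]) simp
  qed
  moreover have "standard_normalized_tight_frame ip J (g \<i>)"
    "standard_normalized_tight_frame ip J (g (- \<i>))"
    by (rule tight; simp)+
  ultimately show ?thesis by blast
qed

end
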